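(* Let $3/2<p<2$, let $q=p/(p-1)$, and let $g\in L^p(\mathbb{D})$. Then $\mathcal{C}[g]\in L^q(\mathbb{D})$, so that $\mathcal{C}$ is an operator from $L^p(\mathbb{D})$ to $L^q(\mathbb{D})$. Moreover, $$\|\mathcal{C}\|_{L^p\to L^q}^q\leq 2^{3/2}\left(\frac{2}{2-q/p}+\frac{1}{\Gamma(2-q/p)}\right).$$
   Context: $\mathbb{D}=\{z\in\mathbb{C}:|z|<1\}$ is the unit disk and $\mathrm{d}A=\frac{1}{\pi}\,\mathrm{d}x\,\mathrm{d}y$ is the normalized area measure. For $1\le p<\infty$, $L^p(\mathbb{D})$ is the space of complex-valued measurable functions $f$ on $\mathbb{D}$ with $\|f\|_p=\left(\int_{\mathbb{D}}|f|^p\,\mathrm{d}A\right)^{1/p}<\infty$. The Cauchy transform of the Dirichlet problem is the operator $$\mathcal{C}[g](z)=\int_{\mathbb{D}}\left(\frac{1}{z-\tau}+\frac{\bar\tau}{1-z\bar\tau}\right)g(\tau)\,\mathrm{d}A(\tau)=\int_{\mathbb{D}}\frac{1-|\tau|^2}{(z-\tau)(1-z\bar\tau)}\,g(\tau)\,\mathrm{d}A(\tau),\qquad z\in\mathbb{D}.$$ The operator norm is $\|\mathcal{C}\|_{L^p\to L^q}=\sup\{\|\mathcal{C}[g]\|_q: g\in L^p(\mathbb{D}),\ \|g\|_p=1\}$. $\Gamma$ denotes the Gamma function. *)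

theory Defs
  imports "HOL-Analysis.Analysis"
begin

abbreviation unit_disk :: "complex set" where
  "unit_disk \<equiv> ball 0 1"

definition disk_area :: "complex measure" where
  "disk_area = density (lebesgue_on unit_disk) (\<lambda>_. ennreal (1 / pi))"

text \<open>Real powers on the extended half-line, meant for a positive exponent.\<close>

definition enn_powr :: "ennreal \<Rightarrow> real \<Rightarrow> ennreal" where
  "enn_powr x s = (if x = \<infinity> then \<infinity> else ennreal (enn2real x powr s))"

definition Lp_norm :: "real \<Rightarrow> (complex \<Rightarrow> complex) \<Rightarrow> ennreal" where
  "Lp_norm p f = enn_powr (\<integral>\<^sup>+z. ennreal (cmod (f z) powr p) \<partial>disk_area) (1 / p)"

text \<open>Elements are functions rather than classes modulo null sets, and only their
  restriction to the disk matters.\<close>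

definition Lp_disk :: "real \<Rightarrow> (complex \<Rightarrow> complex) set" where
  "Lp_disk p = {f \<in> borel_measurable disk_area. Lp_norm p f < \<infinity>}"

definition cauchy_kernel :: "complex \<Rightarrow> complex \<Rightarrow> complex" where
  "cauchy_kernel z w = 1 / (z - w) + cnj w / (1 - z * cnj w)"

lemma cauchy_kernel_altdef:
  assumes "z \<in> unit_disk" "w \<in> unit_disk" "z \<noteq> w"
  shows "cauchy_kernel z w = (1 - (cmod w)\<^sup>2) / ((z - w) * (1 - z * cnj w))"
proof -
  have "cmod z * cmod w < 1 * 1"
    using assms by (intro mult_strict_mono') auto
  hence "cmod (z * cnj w) \<noteq> 1"
    by (simp add: norm_mult)
  hence "1 - z * cnj w \<noteq> 0"
    by (metis eq_iff_diff_eq_0 norm_one)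
  thus ?thesis
    using assms complex_norm_square[of w]
    by (simp add: cauchy_kernel_def divide_simps) (simp add: algebra_simps)
qed

text \<open>The integral takes the value 0 at points where it does not converge absolutely.\<close>

definition cauchy_transform :: "(complex \<Rightarrow> complex) \<Rightarrow> complex \<Rightarrow> complex" where
  "cauchy_transform g z = (\<integral>w. cauchy_kernel z w * g w \<partial>disk_area)"

definition Lp_Lq_opnorm ::
  "real \<Rightarrow> real \<Rightarrow> ((complex \<Rightarrow> complex) \<Rightarrow> complex \<Rightarrow> complex) \<Rightarrow> ennreal" where
  "Lp_Lq_opnorm p q T = (SUP g \<in> {g \<in> Lp_disk p. Lp_norm p g = 1}. Lp_norm q (T g))"

end

theory Submission
  imports Defs "HOL-Complex_Analysis.Riemann_Mapping" "HOL-Real_Asymp.Real_Asymp"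
begin

text \<open>
  For conjugate exponents, Young's inequality for integral operators
  (\<open>nn_integral_kernel_Young\<close>) bounds \<open>\<parallel>T\<parallel>\<close> to the power \<open>q\<close> by the product of the two numbers
  \<open>sup\<^sub>z \<integral> |K(z,w)| powr s dA(w)\<close> and \<open>sup\<^sub>w \<integral> |K(z,w)| powr s dA(z)\<close> with \<open>s = q / 2\<close>. For
  \<open>3/2 < p < 2\<close> this \<open>s\<close> lies between 1 and 3/2, so the singularity of the Cauchy kernel on the
  diagonal is integrable to the power \<open>s\<close>, although it is not to the power \<open>q\<close>.

  Each of the two numbers is at most \<open>2 / (2 - s)\<close> (\<open>nn_integral_cauchy_kernel_left\<close>,
  \<open>nn_integral_cauchy_kernel_right\<close>). A disk automorphism moves the singularity to the origin
  and gives the kernel a simple form; in polar coordinates the integrals over circles are the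
  elementary means of \<open>1 / |1 - b cis \<theta>|\<^sup>2\<close> and \<open>1 / |1 - b cis \<theta>| ^ 4\<close>, and the radial integrals
  that remain have explicit primitives and are bounded independently of the fixed point. Both the
  automorphism and polar coordinates (as the map \<open>\<zeta> \<mapsto> exp (- \<zeta>)\<close>) are injective holomorphic
  substitutions, so a single change of variables serves for both.

  The resulting estimate \<open>\<parallel>C\<parallel> powr q \<le> (4 / (4 - q))\<^sup>2\<close> is stronger than the stated one: since
  \<open>2 - q/p = 3 - q\<close>, the term \<open>2 powr (3/2) * 2 / (3 - q)\<close> alone already exceeds it.
\<close>

section \<open>Holomorphic substitution in planar integrals\<close>

text \<open>
  A linear map that permutes the standard basis vectors carries boxes to boxes with the same
  side lengths. This identifies Lebesgue measure on the complex plane with that on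
  \<^typ>\<open>real^2\<close>, where the Jacobian is a determinant, and with the product measure that
  Tonelli's theorem needs.
\<close>

lemma distr_lborel_Basis:
  fixes f :: "'a::euclidean_space \<Rightarrow> 'b::euclidean_space"
  assumes "linear f" and bij: "bij_betw f Basis Basis"
  shows "distr lborel borel f = lborel"
proof (rule sym, rule lborel_eqI)
  interpret linear f by fact
  have f_borel [measurable]: "f \<in> borel_measurable borel"
    by (intro borel_measurable_continuous_onI linear_continuous_on linear_linear[THEN iffD2] assms
      linear_conv_bounded_linear[THEN iffD1])
  have inner: "f x \<bullet> f b = x \<bullet> b" if "b \<in> Basis" for x b
  proof -
    have "f x \<bullet> f b = (\<Sum>c\<in>Basis. (x \<bullet> c) * (f c \<bullet> f b))"
      by (subst euclidean_representation[of x, symmetric]) (simp add: sum scale inner_sum_left)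
    also have "\<dots> = (\<Sum>c\<in>Basis. (x \<bullet> c) * (if c = b then 1 else 0))"
    proof (intro sum.cong refl)
      fix c :: 'a assume "c \<in> Basis"
      then have "f c \<in> Basis" "f b \<in> Basis" "f c = f b \<longleftrightarrow> c = b"
        using bij that by (auto simp: bij_betw_def inj_on_eq_iff)
      then show "(x \<bullet> c) * (f c \<bullet> f b) = (x \<bullet> c) * (if c = b then 1 else 0)"
        by (simp add: inner_Basis)
    qed
    also have "\<dots> = x \<bullet> b"
      using that by (simp add: if_distrib[of "(*) _"] cong: if_cong)
    finally show ?thesis .
  qed
  fix l u :: 'b
  assume le: "\<And>b. b \<in> Basis \<Longrightarrow> l \<bullet> b \<le> u \<bullet> b"
  define L U where "L = (\<Sum>b\<in>Basis. (l \<bullet> f b) *\<^sub>R b)" and "U = (\<Sum>b\<in>Basis. (u \<bullet> f b) *\<^sub>R b)"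
  have L: "L \<bullet> b = l \<bullet> f b" and U: "U \<bullet> b = u \<bullet> f b" if "b \<in> Basis" for b
    using that by (simp_all add: L_def U_def)
  have image: "f ` Basis = Basis"
    using bij by (simp add: bij_betw_def)
  have "f -` box l u = box L U"
    unfolding box_def image[symmetric] by (auto simp: inner L U)
  then have "emeasure (distr lborel borel f) (box l u) = emeasure lborel (box L U)"
    by (simp add: emeasure_distr)
  also have "\<dots> = (\<Prod>b\<in>Basis. (U - L) \<bullet> b)"
    using le image by (subst emeasure_lborel_box) (auto simp: L U)
  also have "(\<Prod>b\<in>Basis. (U - L) \<bullet> b) = (\<Prod>b\<in>Basis. (u - l) \<bullet> f b)"
    by (intro prod.cong refl) (simp add: inner_diff_left L U)
  also have "\<dots> = (\<Prod>b\<in>Basis. (u - l) \<bullet> b)"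
    using bij by (rule prod.reindex_bij_betw)
  finally show "emeasure (distr lborel borel f) (box l u) = ennreal (\<Prod>b\<in>Basis. (u - l) \<bullet> b)" .
qed simp

text \<open>
  For a nonnegative real integrand, absolute integrability is the same as integrability, so
  the vector-valued change of variables applies to it through \<^typ>\<open>real^1\<close>.
\<close>

lemma has_integral_change_of_variables_nonneg:
  fixes F :: "real^'n::{finite,wellorder} \<Rightarrow> real" and g :: "real^'n::_ \<Rightarrow> real^'n::_"
  assumes "S \<in> sets lebesgue"
    and "\<And>x. x \<in> S \<Longrightarrow> (g has_derivative g' x) (at x within S)"
    and "inj_on g S"
    and nonneg: "\<And>x. 0 \<le> F x"
  shows "((\<lambda>x. \<bar>det (matrix (g' x))\<bar> * F (g x)) has_integral b) S \<longleftrightarrow> (F has_integral b) (g ` S)"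
proof -
  have "(\<lambda>x. \<bar>det (matrix (g' x))\<bar> *\<^sub>R (vec (F (g x)) :: real^1)) absolutely_integrable_on S \<and>
          integral S (\<lambda>x. \<bar>det (matrix (g' x))\<bar> *\<^sub>R (vec (F (g x)) :: real^1)) = vec b
     \<longleftrightarrow> (\<lambda>x. vec (F x) :: real^1) absolutely_integrable_on (g ` S) \<and>
          integral (g ` S) (\<lambda>x. vec (F x) :: real^1) = vec b"
    by (rule has_absolute_integral_change_of_variables) fact+
  then show ?thesis
    unfolding absolutely_integrable_on_1_iff integral_on_1_eq
    using nonneg by (simp add: has_integral_iff absolutely_integrable_on_iff_nonneg)
qed

lemma nn_integral_eq_iff_has_integral:
  fixes F :: "'a::euclidean_space \<Rightarrow> real"
  assumes [measurable]: "F \<in> borel_measurable borel" "S \<in> sets borel"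
    and nonneg: "\<And>x. 0 \<le> F x" and "0 \<le> r"
  shows "(\<integral>\<^sup>+x. ennreal (F x) * indicator S x \<partial>lborel) = ennreal r \<longleftrightarrow> (F has_integral r) S"
proof -
  have 1: "(\<integral>\<^sup>+x. ennreal (F x) * indicator S x \<partial>lborel)
      = (\<integral>\<^sup>+x. ennreal (F x * indicator S x) \<partial>lborel)"
    by (intro nn_integral_cong) (auto split: split_indicator)
  have "(\<lambda>x. F x * indicator S x) = (\<lambda>x. if x \<in> S then F x else 0)"
    by (auto split: split_indicator)
  then have 2: "(F has_integral r) S \<longleftrightarrow> ((\<lambda>x. F x * indicator S x) has_integral r) UNIV"
    by (simp add: has_integral_restrict_UNIV)
  show ?thesis
    unfolding 1 2
    using nn_integral_has_integral[of "\<lambda>x. F x * indicator S x" r]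
      nn_integral_has_integral_lborel[of "\<lambda>x. F x * indicator S x" r] assms by auto
qed

text \<open>
  A nonnegative integral is determined by the finite values that it could equal, and each of
  these is decided by the Henstock-Kurzweil version; hence both sides also agree when they
  are infinite.
\<close>

lemma nn_integral_change_of_variables:
  fixes F :: "real^'n::{finite,wellorder} \<Rightarrow> real" and g :: "real^'n::_ \<Rightarrow> real^'n::_"
  assumes [measurable]: "F \<in> borel_measurable borel" "S \<in> sets borel" "g ` S \<in> sets borel"
    "(\<lambda>x. \<bar>det (matrix (g' x))\<bar> * F (g x)) \<in> borel_measurable borel"
    and "\<And>x. x \<in> S \<Longrightarrow> (g has_derivative g' x) (at x within S)"
    and "inj_on g S"
    and nonneg: "\<And>x. 0 \<le> F x"
  shows "(\<integral>\<^sup>+y. ennreal (F y) * indicator (g ` S) y \<partial>lborel)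
    = (\<integral>\<^sup>+x. ennreal (\<bar>det (matrix (g' x))\<bar> * F (g x)) * indicator S x \<partial>lborel)" (is "?l = ?r")
proof -
  have "?l = ennreal r \<longleftrightarrow> ?r = ennreal r" if "0 \<le> r" for r
    using that assms
    by (simp add: nn_integral_eq_iff_has_integral has_integral_change_of_variables_nonneg)
  then show ?thesis
    by (cases ?l; cases ?r) (metis ennreal_neq_top)+
qed

text \<open>
  By the Cauchy-Riemann equations the real derivative of \<open>f\<close> at \<open>z\<close> is a rotation followed by
  a dilation, with Jacobian determinant \<open>|f'(z)|\<^sup>2\<close>. Differentiability relative to \<open>S\<close> suffices,
  so \<open>S\<close> may be a strip that contains part of its boundary.
\<close>

lemma nn_integral_holomorphic_substitution:
  fixes F :: "complex \<Rightarrow> real" and f f' :: "complex \<Rightarrow> complex"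
  assumes [measurable]: "F \<in> borel_measurable borel" "S \<in> sets borel" "f ` S \<in> sets borel"
      "f \<in> borel_measurable borel" "f' \<in> borel_measurable borel"
    and der: "\<And>z. z \<in> S \<Longrightarrow> (f has_field_derivative f' z) (at z within S)"
    and inj: "inj_on f S"
    and nonneg: "\<And>z. 0 \<le> F z"
  shows "(\<integral>\<^sup>+w. ennreal (F w) * indicator (f ` S) w \<partial>lborel)
    = (\<integral>\<^sup>+z. ennreal ((cmod (f' z))\<^sup>2 * F (f z)) * indicator S z \<partial>lborel)"
proof -
  define to_c :: "real^2 \<Rightarrow> complex" where "to_c = (\<lambda>v. Complex (v$1) (v$2))"
  define of_c :: "complex \<Rightarrow> real^2" where "of_c = (\<lambda>z. vector [Re z, Im z])"
  have inv [simp]: "to_c (of_c z) = z" "of_c (to_c v) = v" for z v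
    by (auto simp: to_c_def of_c_def vec_eq_iff exhaust_2 forall_2)
  have to_c_lin: "linear to_c"
    by (auto simp: linear_iff to_c_def complex_eq_iff)
  have of_c_lin: "linear of_c"
    by (auto simp: linear_iff of_c_def vec_eq_iff forall_2)
  have [measurable]: "to_c \<in> borel_measurable borel" "of_c \<in> borel_measurable borel"
    using to_c_lin of_c_lin
    by (auto intro!: borel_measurable_continuous_onI linear_continuous_on 
      simp: linear_conv_bounded_linear)
  have basis2: "(Basis :: (real^2) set) = {axis 1 1, axis 2 1}"
    by (auto simp: Basis_vec_def UNIV_2)
  have "to_c (axis 1 1) = 1" "to_c (axis 2 1) = \<i>"
    by (auto simp: to_c_def complex_eq_iff axis_def)
  then have "bij_betw to_c Basis Basis"
    by (auto simp: bij_betw_def basis2 Basis_complex_def)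
  then have distr: "distr lborel borel to_c = lborel"
    by (rule distr_lborel_Basis[OF to_c_lin])
  have nn: "(\<integral>\<^sup>+w. h w \<partial>lborel) = (\<integral>\<^sup>+v. h (to_c v) \<partial>lborel)"
    if "h \<in> borel_measurable borel" for h :: "complex \<Rightarrow> ennreal"
    using that by (subst distr[symmetric]) (simp add: nn_integral_distr)
  have der': "((of_c \<circ> f \<circ> to_c) has_derivative (of_c \<circ> (\<lambda>h. f' (to_c v) * h) \<circ> to_c)) (at v within to_c -` S)"
    if "to_c v \<in> S" for v
  proof -
    have "(f has_derivative (\<lambda>h. f' (to_c v) * h)) (at (to_c v) within to_c ` (to_c -` S))"
      using der[OF that] unfolding has_field_derivative_def
      by (rule has_derivative_subset) auto
    then show ?thesis
      using to_c_lin of_c_lin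
      by (intro diff_chain_within linear_imp_has_derivative) (auto simp: o_def)
  qed
  have det: "\<bar>det (matrix (of_c \<circ> (\<lambda>h. a * h) \<circ> to_c))\<bar> = (cmod a)\<^sup>2" for a
    by (simp add: det_2 matrix_def of_c_def to_c_def axis_def cmod_power2) (simp add: power2_eq_square)
  have image: "(of_c \<circ> f \<circ> to_c) ` (to_c -` S) = to_c -` (f ` S)"
  proof (intro equalityI subsetI)
    fix v assume "v \<in> to_c -` (f ` S)"
    then obtain z where "z \<in> S" "to_c v = f z" by auto
    then show "v \<in> (of_c \<circ> f \<circ> to_c) ` (to_c -` S)"
      by (intro image_eqI[of _ _ "of_c z"]) (auto, metis inv(2))
  qed auto
  have "(\<integral>\<^sup>+w. ennreal (F w) * indicator (f ` S) w \<partial>lborel)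
    = (\<integral>\<^sup>+v. ennreal ((F \<circ> to_c) v) * indicator ((of_c \<circ> f \<circ> to_c) ` (to_c -` S)) v \<partial>lborel)"
    unfolding image by (subst nn) (auto simp: indicator_def)
  also have "\<dots> = (\<integral>\<^sup>+v. ennreal (\<bar>det (matrix (of_c \<circ> (\<lambda>h. f' (to_c v) * h) \<circ> to_c))\<bar>
       * (F \<circ> to_c) ((of_c \<circ> f \<circ> to_c) v)) * indicator (to_c -` S) v \<partial>lborel)"
  proof (rule nn_integral_change_of_variables)
    show "inj_on (of_c \<circ> f \<circ> to_c) (to_c -` S)"
      using inj by (auto simp: inj_on_def) (metis inv)
    show "to_c -` S \<in> sets borel" "(of_c \<circ> f \<circ> to_c) ` (to_c -` S) \<in> sets borel"
      unfolding image by (auto intro!: measurable_sets_borel[where M=borel])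
    show "(\<lambda>v. \<bar>det (matrix (of_c \<circ> (*) (f' (to_c v)) \<circ> to_c))\<bar> * (F \<circ> to_c) ((of_c \<circ> f \<circ> to_c) v))
      \<in> borel_measurable borel"
      unfolding det by simp
  qed (use der' nonneg in auto)
  also have "\<dots> = (\<integral>\<^sup>+z. ennreal ((cmod (f' z))\<^sup>2 * F (f z)) * indicator S z \<partial>lborel)"
    unfolding det by (subst nn) (auto simp: indicator_def)
  finally show ?thesis .
qed

lemma lborel_complex_eq_distr_pair:
  "(lborel :: complex measure) = distr (lborel \<Otimes>\<^sub>M lborel) borel (\<lambda>(x, y). Complex x y)"
proof -
  let ?f = "\<lambda>(x, y). Complex x y"
  have "linear ?f"
    by (auto simp: linear_iff complex_eq_iff split: prod.splits)
  moreover have "bij_betw ?f Basis Basis"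
    by (auto simp: bij_betw_def Basis_prod_def Basis_complex_def inj_on_def complex_eq_iff image_iff)
  ultimately show ?thesis
    by (simp add: distr_lborel_Basis lborel_prod)
qed

section \<open>Integration over the disk\<close>

lemma space_disk_area: "space disk_area = unit_disk"
  by (simp add: disk_area_def)

lemma nn_integral_disk_area:
  assumes [measurable]: "F \<in> borel_measurable borel"
  shows "(\<integral>\<^sup>+z. F z \<partial>disk_area) = ennreal (1 / pi) * (\<integral>\<^sup>+z. F z * indicator unit_disk z \<partial>lborel)"
proof -
  have [measurable]: "unit_disk \<in> sets borel" by simp
  have [measurable]: "F \<in> borel_measurable lebesgue"
    by (intro measurable_completion) simp
  have "(\<integral>\<^sup>+z. F z \<partial>disk_area) = (\<integral>\<^sup>+z. ennreal (1 / pi) * F z \<partial>lebesgue_on unit_disk)"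
    unfolding disk_area_def
    by (intro nn_integral_density) (auto intro!: measurable_restrict_space1)
  also have "\<dots> = (\<integral>\<^sup>+z. ennreal (1 / pi) * F z * indicator unit_disk z \<partial>lebesgue)"
    by (subst nn_integral_restrict_space) auto
  also have "\<dots> = (\<integral>\<^sup>+z. ennreal (1 / pi) * (F z * indicator unit_disk z) \<partial>lborel)"
    by (subst nn_integral_completion) (auto simp: mult.assoc)
  also have "\<dots> = ennreal (1 / pi) * (\<integral>\<^sup>+z. F z * indicator unit_disk z \<partial>lborel)"
    by (intro nn_integral_cmult) simp
  finally show ?thesis .
qed

lemma one_plus_cnj_mult_nonzero:
  assumes "cmod w < 1" "cmod z < 1"
  shows "1 + cnj w * z \<noteq> 0"
proof
  assume "1 + cnj w * z = 0"
  then have "cmod (cnj w * z) = 1"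
    by (metis add_eq_0_iff norm_minus_cancel norm_one)
  moreover have "cmod w * cmod z < 1 * 1"
    using assms by (intro mult_strict_mono') auto
  ultimately show False by (simp add: norm_mult)
qed

text \<open>
  The map \<open>z \<mapsto> (z + w) / (1 + cnj w * z)\<close> is an automorphism of the disk that sends 0 to \<open>w\<close>;
  its derivative is \<open>(1 - |w|\<^sup>2) / (1 + cnj w * z)\<^sup>2\<close>.
\<close>

lemma nn_integral_disk_area_Moebius:
  fixes F :: "complex \<Rightarrow> real"
  assumes [measurable]: "F \<in> borel_measurable borel" and nonneg: "\<And>z. 0 \<le> F z"
    and w: "w \<in> unit_disk"
  shows "(\<integral>\<^sup>+z. ennreal (F z) \<partial>disk_area)
    = (\<integral>\<^sup>+z. ennreal ((1 - (cmod w)\<^sup>2)\<^sup>2 / cmod (1 + cnj w * z) ^ 4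
          * F ((z + w) / (1 + cnj w * z))) \<partial>disk_area)"
proof -
  define f where "f = (\<lambda>z. (z + w) / (1 + cnj w * z))"
  define f' where "f' = (\<lambda>z. (1 - cnj w * w) / (1 + cnj w * z)\<^sup>2)"
  have f_eq: "f = Moebius_function 0 (- w)"
    by (simp add: fun_eq_iff f_def Moebius_function_simple)
  have w': "cmod w < 1" using w by simp
  have nz: "1 + cnj w * z \<noteq> 0" if "z \<in> unit_disk" for z
    using one_plus_cnj_mult_nonzero[OF w'] that by simp
  have inv: "f (Moebius_function 0 w z) = z" "Moebius_function 0 w (f z) = z" if "cmod z < 1" for z
    using that w' by (auto simp: f_eq intro!: Moebius_function_compose)
  have image: "f ` unit_disk = unit_disk"
  proof (intro equalityI subsetI)
    fix z assume "z \<in> unit_disk"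
    then show "z \<in> f ` unit_disk"
      using inv(1)[of z] Moebius_function_norm_lt_1[of w z 0] w' by (intro image_eqI[of _ _ "Moebius_function 0 w z"]) auto
  qed (use Moebius_function_norm_lt_1[of "- w" _ 0] w' in \<open>auto simp: f_eq\<close>)
  have [measurable]: "f \<in> borel_measurable borel" "f' \<in> borel_measurable borel"
    unfolding f_def f'_def by measurable
  have sq: "(cmod (f' z))\<^sup>2 = (1 - (cmod w)\<^sup>2)\<^sup>2 / cmod (1 + cnj w * z) ^ 4" for z
  proof -
    have "1 - cnj w * w = of_real (1 - (cmod w)\<^sup>2)"
      by (simp add: complex_norm_square mult.commute del: of_real_power)
    then have "cmod (1 - cnj w * w) = \<bar>1 - (cmod w)\<^sup>2\<bar>"
      by (simp only: norm_of_real)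
    then show ?thesis
      by (simp add: f'_def norm_divide norm_power power_divide)
  qed
  have "(\<integral>\<^sup>+z. ennreal (F z) * indicator (f ` unit_disk) z \<partial>lborel)
    = (\<integral>\<^sup>+z. ennreal ((cmod (f' z))\<^sup>2 * F (f z)) * indicator unit_disk z \<partial>lborel)"
  proof (rule nn_integral_holomorphic_substitution)
    show "inj_on f unit_disk"
      using inv(2) by (metis inj_onI mem_ball_0)
    show "(f has_field_derivative f' z) (at z within unit_disk)" if "z \<in> unit_disk" for z
      unfolding f_def f'_def using nz[OF that]
      by (auto intro!: derivative_eq_intros simp: field_simps power2_eq_square)
  qed (auto simp: image nonneg)
  then show ?thesis
    unfolding image sq by (simp add: nn_integral_disk_area f_def)
qed

text \<open>
  The holomorphic map \<open>\<zeta> \<mapsto> exp (- \<zeta>)\<close> takes the half-strip \<open>0 < Re \<zeta>\<close>, \<open>- \<pi> \<le> Im \<zeta> < \<pi>\<close>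
  injectively onto the punctured disk. Polar coordinates with radius \<open>exp (- t)\<close> are therefore
  a case of the holomorphic substitution rule.
\<close>

lemma nn_integral_disk_area_polar:
  fixes F :: "complex \<Rightarrow> real"
  assumes [measurable]: "F \<in> borel_measurable borel" and nonneg: "\<And>z. 0 \<le> F z"
  shows "(\<integral>\<^sup>+z. ennreal (F z) \<partial>disk_area)
    = ennreal (1 / pi) * (\<integral>\<^sup>+t. (\<integral>\<^sup>+\<theta>. ennreal (exp (- 2 * t) * F (of_real (exp (- t)) * cis \<theta>))
          * indicator {- pi<..pi} \<theta> \<partial>lborel) * indicator {0<..} t \<partial>lborel)"
proof -
  define S where "S = {z. 0 < Re z \<and> Im z \<in> {- pi..<pi}}"
  define h where "h = (\<lambda>z::complex. exp (- z))"
  have [measurable]: "S \<in> sets borel"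
    unfolding S_def by measurable
  have image: "h ` S = unit_disk - {0}"
  proof (intro equalityI subsetI)
    fix w :: complex assume w: "w \<in> unit_disk - {0}"
    then have "h (- Ln w) = w" "- Ln w \<in> S"
      using mpi_less_Im_Ln[of w] Im_Ln_le_pi[of w] by (auto simp: h_def S_def)
    then show "w \<in> h ` S" by force
  qed (auto simp: h_def S_def)
  have inj: "inj_on h S"
  proof (rule inj_onI)
    fix z w assume zw: "z \<in> S" "w \<in> S" "h z = h w"
    have "Ln (h z) = - z" "Ln (h w) = - w"
      using zw(1,2) unfolding h_def by (auto intro!: Ln_exp simp: S_def)
    with zw(3) have "- z = - w" by metis
    then show "z = w" by (simp only: neg_equal_iff_equal)
  qed
  have [measurable]: "h \<in> borel_measurable borel"
    unfolding h_def by (intro borel_measurable_continuous_onI continuous_intros)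
  have [measurable]: "(\<lambda>(x, y). Complex x y) \<in> borel_measurable (borel \<Otimes>\<^sub>M borel)"
    unfolding Complex_eq case_prod_unfold by measurable
  have [measurable]: "(\<lambda>x. Complex (f x) (g x)) \<in> borel_measurable M"
    if [measurable]: "f \<in> borel_measurable M" "g \<in> borel_measurable M" for f g and M :: "'m measure"
    unfolding Complex_eq by measurable
  \<comment> \<open>The sign in the exponential reverses the angle.\<close>
  have reflect: "(\<integral>\<^sup>+\<theta>. u \<theta> \<partial>lborel) = (\<integral>\<^sup>+\<theta>. u (- \<theta>) \<partial>lborel)"
    if "u \<in> borel_measurable borel" for u :: "real \<Rightarrow> ennreal"
    using that by (subst lborel_distr_uminus[symmetric]) (simp add: nn_integral_distr)
  have AE: "AE z in lborel. z \<noteq> (0::complex)"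
    by (rule AE_lborel_singleton)
  have "(\<integral>\<^sup>+z. ennreal (F z) * indicator unit_disk z \<partial>lborel)
    = (\<integral>\<^sup>+z. ennreal (F z) * indicator (h ` S) z \<partial>lborel)"
    unfolding image using AE
    by (intro nn_integral_cong_AE) (auto split: split_indicator elim!: eventually_mono)
  also have "\<dots> = (\<integral>\<^sup>+z. ennreal ((cmod (- h z))\<^sup>2 * F (h z)) * indicator S z \<partial>lborel)"
  proof (rule nn_integral_holomorphic_substitution)
    show "(h has_field_derivative - h z) (at z within S)" for z
      unfolding h_def by (auto intro!: derivative_eq_intros)
  qed (use inj nonneg in \<open>auto simp: image\<close>)
  also have "\<dots> = (\<integral>\<^sup>+(t,\<theta>). ennreal ((cmod (h (Complex t \<theta>)))\<^sup>2 * F (h (Complex t \<theta>)))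
      * indicator S (Complex t \<theta>) \<partial>(lborel \<Otimes>\<^sub>M lborel))"
    by (subst lborel_complex_eq_distr_pair) (simp add: nn_integral_distr case_prod_unfold)
  also have "\<dots> = (\<integral>\<^sup>+t. (\<integral>\<^sup>+\<theta>. ennreal ((cmod (h (Complex t \<theta>)))\<^sup>2 * F (h (Complex t \<theta>)))
      * indicator S (Complex t \<theta>) \<partial>lborel) \<partial>lborel)"
    by (subst lborel.nn_integral_fst[symmetric]) simp_all
  also have "\<dots> = (\<integral>\<^sup>+t. (\<integral>\<^sup>+\<theta>. ennreal ((cmod (h (Complex t (- \<theta>))))\<^sup>2 * F (h (Complex t (- \<theta>))))
      * indicator S (Complex t (- \<theta>)) \<partial>lborel) \<partial>lborel)"
    by (rule nn_integral_cong, rule reflect) measurable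
  also have "\<dots> = (\<integral>\<^sup>+t. (\<integral>\<^sup>+\<theta>. ennreal (exp (- 2 * t) * F (of_real (exp (- t)) * cis \<theta>))
          * indicator {- pi<..pi} \<theta> \<partial>lborel) * indicator {0<..} t \<partial>lborel)"
  proof (intro nn_integral_cong)
    fix t :: real
    have "h (Complex t (- \<theta>)) = of_real (exp (- t)) * cis \<theta>" for \<theta>
      by (simp add: h_def complex_eq_iff Re_exp Im_exp)
    moreover have "(exp (- t))\<^sup>2 = exp (- 2 * t)"
      by (simp add: power2_eq_square flip: exp_add)
    ultimately show "(\<integral>\<^sup>+\<theta>. ennreal ((cmod (h (Complex t (- \<theta>))))\<^sup>2 * F (h (Complex t (- \<theta>))))
      * indicator S (Complex t (- \<theta>)) \<partial>lborel) = (\<integral>\<^sup>+\<theta>. ennreal (exp (- 2 * t) * F (of_real (exp (- t)) * cis \<theta>))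
          * indicator {- pi<..pi} \<theta> \<partial>lborel) * indicator {0<..} t"
      by (auto simp: norm_mult S_def intro!: nn_integral_cong split: split_indicator)
  qed
  finally show ?thesis
    by (simp add: nn_integral_disk_area)
qed

lemma borel_measurable_cis [measurable]: "cis \<in> borel_measurable borel"
  by (intro borel_measurable_continuous_onI continuous_intros)

text \<open>
  On the circle \<open>c = b cis \<theta>\<close> put \<open>v = 1 / (1 - c)\<close>. From \<open>c = 1 - 1 / v\<close> one gets
  \<open>|v|\<^sup>2 (1 - |b|\<^sup>2) = 2 Re v - 1\<close>; squaring this and using \<open>2 (Re v)\<^sup>2 = Re (v\<^sup>2) + |v|\<^sup>2\<close> writes
  \<open>|v|\<^sup>2\<close> and \<open>|v|\<^sup>4\<close> as real linear combinations of \<open>1\<close>, \<open>Re v\<close> and \<open>Re (v\<^sup>2)\<close>. The latter two have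
  the primitives \<open>\<theta> + Re (\<i> Ln (1 - c))\<close> and \<open>\<theta> + Re (\<i> Ln (1 - c)) - Re (\<i> v)\<close>, where the
  logarithm is harmless because \<open>1 - c\<close> stays in the right half-plane. All periodic terms
  cancel at the endpoints.
\<close>

lemma circle_integrals:
  fixes b :: complex
  assumes b: "cmod b < 1"
  shows nn_integral_circle_inverse_power2:
    "(\<integral>\<^sup>+\<theta>. ennreal (1 / cmod (1 - b * cis \<theta>) ^ 2) * indicator {- pi..pi} \<theta> \<partial>lborel)
      = ennreal (2 * pi / (1 - (cmod b)\<^sup>2))" (is ?thesis1)
   and nn_integral_circle_inverse_power4:
    "(\<integral>\<^sup>+\<theta>. ennreal (1 / cmod (1 - b * cis \<theta>) ^ 4) * indicator {- pi..pi} \<theta> \<partial>lborel)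
      = ennreal (2 * pi * (1 + (cmod b)\<^sup>2) / (1 - (cmod b)\<^sup>2) ^ 3)" (is ?thesis2)
proof -
  define v where "v = (\<lambda>\<theta>. 1 / (1 - b * cis \<theta>))"
  define \<beta> where "\<beta> = (cmod b)\<^sup>2"
  have \<beta>: "\<beta> < 1" "0 \<le> \<beta>"
    using b by (simp_all add: \<beta>_def abs_square_less_1)
  have Re_pos: "0 < Re (1 - b * cis \<theta>)" for \<theta>
    using complex_Re_le_cmod[of "b * cis \<theta>"] b by (simp add: norm_mult)
  then have nz: "1 - b * cis \<theta> \<noteq> 0" for \<theta>
    by (metis less_irrefl zero_complex.sel(1))
  have not_neg: "1 - b * cis \<theta> \<notin> \<real>\<^sub>\<le>\<^sub>0" for \<theta>
    using Re_pos[of \<theta>] by (auto simp: complex_nonpos_Reals_iff)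
  have v_nz: "v \<theta> \<noteq> 0" for \<theta> using nz by (simp add: v_def)
  define V1 where "V1 = (\<lambda>\<theta>. \<theta> + Re (\<i> * Ln (1 - b * cis \<theta>)))"
  define V2 where "V2 = (\<lambda>\<theta>. V1 \<theta> - Re (\<i> * v \<theta>))"
  have c: "b * cis \<theta> = 1 - 1 / v \<theta>" for \<theta> using nz by (simp add: v_def)
  have chain: "((\<lambda>\<theta>. g (b * cis \<theta>)) has_vector_derivative \<i> * (b * cis \<theta>) * g') (at \<theta>)"
    if "(g has_field_derivative g') (at (b * cis \<theta>))" for g g' \<theta>
  proof -
    have "((\<lambda>\<theta>. b * cis \<theta>) has_derivative (\<lambda>t. t *\<^sub>R (\<i> * (b * cis \<theta>)))) (at \<theta>)"
      by (auto intro!: derivative_eq_intros simp: mult_ac)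
    then show ?thesis
      using that field_vector_diff_chain_at[of "\<lambda>\<theta>. b * cis \<theta>" _ \<theta> g g']
      by (simp add: has_vector_derivative_def o_def)
  qed
  have 1: "(V1 has_real_derivative Re (v \<theta>)) (at \<theta>)" for \<theta>
  proof -
    have "((\<lambda>c. \<i> * Ln (1 - c)) has_field_derivative - (\<i> * v \<theta>)) (at (b * cis \<theta>))"
      using not_neg[of \<theta>] nz[of \<theta>] by (auto intro!: derivative_eq_intros simp: v_def field_simps)
    from DERIV_add[OF DERIV_ident has_field_derivative_Re[OF chain[OF this]]]
    have "(V1 has_real_derivative 1 + Re (\<i> * (b * cis \<theta>) * - (\<i> * v \<theta>))) (at \<theta>)"
      unfolding V1_def .
    also have "\<i> * (b * cis \<theta>) * - (\<i> * v \<theta>) = v \<theta> - 1"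
      using v_nz[of \<theta>] unfolding c by (simp add: field_simps)
    finally show ?thesis by simp
  qed
  have 2: "(V2 has_real_derivative Re ((v \<theta>)\<^sup>2)) (at \<theta>)" for \<theta>
  proof -
    have "((\<lambda>c. \<i> * (1 / (1 - c))) has_field_derivative \<i> * (v \<theta>)\<^sup>2) (at (b * cis \<theta>))"
      using nz[of \<theta>] by (auto intro!: derivative_eq_intros simp: v_def field_simps power2_eq_square)
    note deriv = has_field_derivative_Re[OF chain[OF this]]
    have "((\<lambda>\<theta>. Re (\<i> * v \<theta>)) has_real_derivative Re (\<i> * (b * cis \<theta>) * (\<i> * (v \<theta>)\<^sup>2))) (at \<theta>)"
      using deriv unfolding v_def .
    from DERIV_diff[OF 1 this]
    have "(V2 has_real_derivative Re (v \<theta>) - Re (\<i> * (b * cis \<theta>) * (\<i> * (v \<theta>)\<^sup>2))) (at \<theta>)"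
      unfolding V2_def .
    also have "\<i> * (b * cis \<theta>) * (\<i> * (v \<theta>)\<^sup>2) = v \<theta> - (v \<theta>)\<^sup>2"
      using v_nz[of \<theta>] unfolding c by (simp add: field_simps power2_eq_square)
    finally show ?thesis by simp
  qed
  have sq: "(cmod (v \<theta>))\<^sup>2 * (1 - \<beta>) = 2 * Re (v \<theta>) - 1" for \<theta>
  proof -
    have "\<beta> * (cmod (v \<theta>))\<^sup>2 = (cmod (b * cis \<theta> * v \<theta>))\<^sup>2"
      by (simp add: \<beta>_def norm_mult power_mult_distrib)
    also have "b * cis \<theta> * v \<theta> = v \<theta> - 1"
      using v_nz by (simp add: c field_simps)
    also have "(cmod (v \<theta> - 1))\<^sup>2 = (cmod (v \<theta>))\<^sup>2 - 2 * Re (v \<theta>) + 1"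
      by (simp add: cmod_power2) (simp add: power2_eq_square algebra_simps)
    finally show ?thesis by (simp add: algebra_simps)
  qed
  have Re_sq: "2 * (Re (v \<theta>))\<^sup>2 = Re ((v \<theta>)\<^sup>2) + (cmod (v \<theta>))\<^sup>2" for \<theta>
    by (simp add: cmod_power2 Re_power2)
  \<comment> \<open>Primitives of \<open>|v|\<^sup>2\<close> and \<open>|v|\<^sup>4\<close>.\<close>
  define P1 where "P1 = (\<lambda>\<theta>. (2 * V1 \<theta> - \<theta>) / (1 - \<beta>))"
  define P2 where "P2 = (\<lambda>\<theta>. (2 * V2 \<theta> + 2 * P1 \<theta> - 4 * V1 \<theta> + \<theta>) / (1 - \<beta>)\<^sup>2)"
  have P1: "(P1 has_real_derivative (1 / cmod (1 - b * cis \<theta>) ^ 2)) (at \<theta>)" for \<theta>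
  proof -
    have "(P1 has_real_derivative ((2 * Re (v \<theta>) - 1) / (1 - \<beta>))) (at \<theta>)"
      unfolding P1_def using 1 \<beta> by (auto intro!: derivative_eq_intros)
    also have "(2 * Re (v \<theta>) - 1) / (1 - \<beta>) = (cmod (v \<theta>))\<^sup>2"
      using \<beta> sq[of \<theta>] by (simp add: field_simps)
    also have "\<dots> = 1 / cmod (1 - b * cis \<theta>) ^ 2"
      by (simp add: v_def norm_divide power_divide)
    finally show ?thesis .
  qed
  have P2: "(P2 has_real_derivative (1 / cmod (1 - b * cis \<theta>) ^ 4)) (at \<theta>)" for \<theta>
  proof -
    have "(P2 has_real_derivative ((2 * Re ((v \<theta>)\<^sup>2) + 2 * (1 / cmod (1 - b * cis \<theta>) ^ 2) - 4 * Re (v \<theta>) + 1) / (1 - \<beta>)\<^sup>2)) (at \<theta>)"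
      unfolding P2_def by (rule DERIV_cdivide) (use 1 2 P1 in \<open>auto intro!: derivative_eq_intros\<close>)
    also have "1 / cmod (1 - b * cis \<theta>) ^ 2 = (cmod (v \<theta>))\<^sup>2"
      by (simp add: v_def norm_divide power_divide)
    also have "2 * Re ((v \<theta>)\<^sup>2) + 2 * (cmod (v \<theta>))\<^sup>2 - 4 * Re (v \<theta>) + 1 = (2 * Re (v \<theta>) - 1)\<^sup>2"
      using Re_sq[of \<theta>] by (simp add: power2_eq_square algebra_simps)
    also have "\<dots> = ((cmod (v \<theta>))\<^sup>2 * (1 - \<beta>))\<^sup>2"
      by (simp add: sq)
    also have "\<dots> / (1 - \<beta>)\<^sup>2 = cmod (v \<theta>) ^ 4"
      using \<beta> by (simp add: power_mult_distrib flip: power_mult)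
    also have "\<dots> = 1 / cmod (1 - b * cis \<theta>) ^ 4"
      by (simp add: v_def norm_divide power_divide)
    finally show ?thesis .
  qed
  have cis_pi: "cis (- pi) = cis pi"
    by (simp add: complex_eq_iff)
  then have ends: "V1 pi - V1 (- pi) = 2 * pi" "V2 pi - V2 (- pi) = 2 * pi"
    by (simp_all add: V1_def V2_def v_def cis_pi)
  have ends1: "P1 pi - P1 (- pi) = 2 * pi / (1 - \<beta>)"
    using ends by (simp add: P1_def flip: diff_divide_distrib)
  have ends2: "P2 pi - P2 (- pi) = 2 * pi * (1 + \<beta>) / (1 - \<beta>) ^ 3"
  proof -
    have "P2 pi - P2 (- pi) = (2 * (V2 pi - V2 (- pi)) + 2 * (P1 pi - P1 (- pi)) - 4 * (V1 pi - V1 (- pi)) + 2 * pi) / (1 - \<beta>)\<^sup>2"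
      by (simp add: P2_def flip: diff_divide_distrib)
    also have "\<dots> = 2 * pi * (1 + \<beta>) / (1 - \<beta>) ^ 3"
      using \<beta> unfolding ends ends1 by (simp add: power2_eq_square power3_eq_cube divide_simps) (simp add: algebra_simps)
    finally show ?thesis .
  qed
  have "(\<integral>\<^sup>+\<theta>. ennreal (1 / cmod (1 - b * cis \<theta>) ^ 2) * indicator {- pi..pi} \<theta> \<partial>lborel) = ennreal (P1 pi - P1 (- pi))"
    by (rule nn_integral_FTC_Icc) (auto intro: P1 DERIV_subset)
  then show ?thesis1 by (simp add: ends1 \<beta>_def)
  have "(\<integral>\<^sup>+\<theta>. ennreal (1 / cmod (1 - b * cis \<theta>) ^ 4) * indicator {- pi..pi} \<theta> \<partial>lborel) = ennreal (P2 pi - P2 (- pi))"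
    by (rule nn_integral_FTC_Icc) (auto intro: P2 DERIV_subset)
  then show ?thesis2 by (simp add: ends2 \<beta>_def)
qed

text \<open>
  The factor \<open>2 exp (- 2 t)\<close> is the density of the normalized area in the variable
  \<open>t = - ln \<rho>\<close>. This leaves an integral over a half-line, to which the fundamental theorem of
  calculus applies even though \<open>G\<close> may blow up at the centre of the disk.
\<close>

lemma nn_integral_disk_area_le_radial:
  fixes F :: "complex \<Rightarrow> real" and G :: "real \<Rightarrow> real"
  assumes [measurable]: "F \<in> borel_measurable borel" "G \<in> borel_measurable borel"
    and F: "\<And>z. 0 \<le> F z" and G: "\<And>\<rho>. 0 < \<rho> \<Longrightarrow> \<rho> < 1 \<Longrightarrow> 0 \<le> G \<rho>"
    and circle: "\<And>\<rho>. 0 < \<rho> \<Longrightarrow> \<rho> < 1 \<Longrightarrow>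
      (\<integral>\<^sup>+\<theta>. ennreal (F (of_real \<rho> * cis \<theta>)) * indicator {- pi..pi} \<theta> \<partial>lborel) \<le> ennreal (2 * pi * G \<rho>)"
  shows "(\<integral>\<^sup>+z. ennreal (F z) \<partial>disk_area)
    \<le> (\<integral>\<^sup>+t. ennreal (2 * exp (- 2 * t) * G (exp (- t))) * indicator {0..} t \<partial>lborel)"
proof -
  have inner: "(\<integral>\<^sup>+\<theta>. ennreal (exp (- 2 * t) * F (of_real (exp (- t)) * cis \<theta>)) * indicator {- pi<..pi} \<theta> \<partial>lborel)
      \<le> ennreal pi * ennreal (2 * exp (- 2 * t) * G (exp (- t)))" if t: "0 < t" for t :: real
  proof -
    have "(\<integral>\<^sup>+\<theta>. ennreal (exp (- 2 * t) * F (of_real (exp (- t)) * cis \<theta>)) * indicator {- pi<..pi} \<theta> \<partial>lborel)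
      \<le> (\<integral>\<^sup>+\<theta>. ennreal (exp (- 2 * t)) * (ennreal (F (of_real (exp (- t)) * cis \<theta>)) * indicator {- pi..pi} \<theta>) \<partial>lborel)"
      using F by (intro nn_integral_mono) (auto simp: ennreal_mult split: split_indicator)
    also have "\<dots> = ennreal (exp (- 2 * t)) * (\<integral>\<^sup>+\<theta>. ennreal (F (of_real (exp (- t)) * cis \<theta>)) * indicator {- pi..pi} \<theta> \<partial>lborel)"
      by (intro nn_integral_cmult) (auto simp: cis.ctr Complex_eq)
    also have "\<dots> \<le> ennreal (exp (- 2 * t)) * ennreal (2 * pi * G (exp (- t)))"
      using t by (intro mult_left_mono circle) auto
    also have "\<dots> = ennreal pi * ennreal (2 * exp (- 2 * t) * G (exp (- t)))"
      using G[of "exp (- t)"] t by (simp add: mult_ac flip: ennreal_mult)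
    finally show ?thesis .
  qed
  have "(\<integral>\<^sup>+z. ennreal (F z) \<partial>disk_area)
    = ennreal (1 / pi) * (\<integral>\<^sup>+t. (\<integral>\<^sup>+\<theta>. ennreal (exp (- 2 * t) * F (of_real (exp (- t)) * cis \<theta>))
          * indicator {- pi<..pi} \<theta> \<partial>lborel) * indicator {0<..} t \<partial>lborel)"
    by (intro nn_integral_disk_area_polar F) simp
  also have "\<dots> \<le> ennreal (1 / pi) * (\<integral>\<^sup>+t. ennreal pi * (ennreal (2 * exp (- 2 * t) * G (exp (- t))) * indicator {0..} t) \<partial>lborel)"
    using inner by (intro mult_left_mono nn_integral_mono) (auto simp: mult_ac split: split_indicator)
  also have "\<dots> = ennreal (1 / pi) * (ennreal pi * (\<integral>\<^sup>+t. ennreal (2 * exp (- 2 * t) * G (exp (- t))) * indicator {0..} t \<partial>lborel))"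
    by (subst nn_integral_cmult) auto
  also have "\<dots> = (\<integral>\<^sup>+t. ennreal (2 * exp (- 2 * t) * G (exp (- t))) * indicator {0..} t \<partial>lborel)"
    by (simp add: mult.assoc[symmetric] flip: ennreal_mult)
  finally show ?thesis .
qed

section \<open>Integrals of powers of the kernel\<close>

lemma one_minus_cmod_sq: "cmod z < 1 \<Longrightarrow> 0 < 1 - (cmod z)\<^sup>2"
  by (simp add: abs_square_less_1)

text \<open>
  Both denominators of the kernel become multiples of \<open>1 / (1 + cnj w * z)\<close>, the first with the
  factor \<open>z\<close>; the singularity moves to the origin, and the remaining factor is a power of
  \<open>|1 + cnj w * z|\<close> that combines with the Jacobian.
\<close>

lemma cauchy_kernel_Moebius_left:
  assumes w: "cmod w < 1" and z: "cmod z < 1" "z \<noteq> 0"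
  shows "cmod (cauchy_kernel ((z + w) / (1 + cnj w * z)) w)
    = (cmod (1 + cnj w * z))\<^sup>2 / (cmod z * (1 - (cmod w)\<^sup>2))"
proof -
  define d where "d = 1 + cnj w * z"
  define y where "y = 1 - w * cnj w"
  have y: "y = of_real (1 - (cmod w)\<^sup>2)"
    by (simp add: y_def complex_norm_square del: of_real_power)
  have nz: "d \<noteq> 0" "y \<noteq> 0"
    using one_plus_cnj_mult_nonzero[OF w z(1)] one_minus_cmod_sq[OF w]
    by (auto simp: d_def y simp del: of_real_diff)
  have "(z + w) / d - w = z * y / d" "1 - (z + w) / d * cnj w = y / d"
    using nz(1) by (simp_all add: field_simps) (simp_all add: d_def y_def algebra_simps)
  then have "cauchy_kernel ((z + w) / d) w = 1 / (z * y / d) + cnj w / (y / d)"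
    by (simp add: cauchy_kernel_def)
  also have "\<dots> = d\<^sup>2 / (z * y)"
    using nz z by (simp add: field_simps) (simp add: d_def algebra_simps power2_eq_square)
  finally show ?thesis
    using one_minus_cmod_sq[OF w]
    by (simp add: d_def norm_divide norm_mult norm_power y del: of_real_diff)
qed

text \<open>
  The kernel is not symmetric; for the automorphism centred at the first argument the factor
  \<open>1 + cnj w * z\<close> cancels completely.
\<close>

lemma cauchy_kernel_Moebius_right:
  assumes w: "cmod w < 1" and z: "cmod z < 1" "z \<noteq> 0"
  shows "cmod (cauchy_kernel w ((z + w) / (1 + cnj w * z)))
    = (1 - (cmod z)\<^sup>2) / (cmod z * (1 - (cmod w)\<^sup>2))"
proof -
  define d where "d = 1 + cnj w * z"
  define y where "y = 1 - w * cnj w"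
  have y: "y = of_real (1 - (cmod w)\<^sup>2)"
    by (simp add: y_def complex_norm_square del: of_real_power)
  have x: "1 - z * cnj z = of_real (1 - (cmod z)\<^sup>2)"
    by (simp add: complex_norm_square del: of_real_power)
  have nz: "d \<noteq> 0" "y \<noteq> 0" "cnj d \<noteq> 0"
    using one_plus_cnj_mult_nonzero[OF w z(1)] one_minus_cmod_sq[OF w]
    by (auto simp: d_def y simp del: of_real_diff complex_cnj_add complex_cnj_mult)
  have "w - (z + w) / d = - (z * y / d)" "1 - w * ((cnj z + cnj w) / cnj d) = y / cnj d"
    using nz by (simp_all add: field_simps) (simp_all add: d_def y_def algebra_simps)
  then have "cauchy_kernel w ((z + w) / d) = 1 / (- (z * y / d)) + (cnj z + cnj w) / cnj d / (y / cnj d)"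
    by (simp add: cauchy_kernel_def)
  also have "\<dots> = - (1 - z * cnj z) / (z * y)"
    using nz z by (simp add: field_simps) (simp add: d_def algebra_simps)
  finally show ?thesis
    using one_minus_cmod_sq[OF w] one_minus_cmod_sq[OF z(1)]
    by (simp add: d_def norm_divide norm_mult x y del: of_real_diff)
qed

lemma measurable_cauchy_kernel [measurable]:
  assumes [measurable]: "f \<in> borel_measurable M" "g \<in> borel_measurable M"
  shows "(\<lambda>x. cauchy_kernel (f x) (g x)) \<in> borel_measurable M"
proof -
  have [measurable]: "cnj \<in> borel_measurable borel"
    by (intro borel_measurable_continuous_onI continuous_intros)
  show ?thesis unfolding cauchy_kernel_def by measurable
qed

text \<open>
  Write \<open>a = 2 - s\<close> and \<open>Y = 1 - |w|\<^sup>2\<close>. After the Moebius substitution the integrand becomes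
  \<open>|z| powr (- s) * (Y / |1 + cnj w * z|\<^sup>2) powr a\<close>. As \<open>a \<le> 1\<close>, the tangent line at 1 gives
  \<open>y powr a \<le> a y + 1 - a\<close>, and on the circle of radius \<open>\<rho>\<close> the mean of
  \<open>y = Y / |1 + cnj w * z|\<^sup>2\<close> is \<open>Y / (1 - |w|\<^sup>2 \<rho>\<^sup>2) \<le> 1\<close>. So the circular means are at most
  \<open>\<rho> powr (- s)\<close>, whose integral over the disk is \<open>2 / a\<close>. For \<open>w = 0\<close> there is equality.
\<close>

lemma nn_integral_cauchy_kernel_left:
  assumes w: "w \<in> unit_disk" and s: "1 \<le> s" "s < 2"
  shows "(\<integral>\<^sup>+z. ennreal (cmod (cauchy_kernel z w) powr s) \<partial>disk_area) \<le> ennreal (2 / (2 - s))"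
proof -
  define a where "a = 2 - s"
  have a: "0 < a" "a \<le> 1" using s by (auto simp: a_def)
  define X where "X = (cmod w)\<^sup>2"
  define Y where "Y = 1 - X"
  have X: "0 \<le> X" "0 < Y" using w by (auto simp: X_def Y_def abs_square_less_1)
  define F where "F = (\<lambda>z. Y\<^sup>2 / cmod (1 + cnj w * z) ^ 4
          * cmod (cauchy_kernel ((z + w) / (1 + cnj w * z)) w) powr s)"
  have "(\<integral>\<^sup>+z. ennreal (cmod (cauchy_kernel z w) powr s) \<partial>disk_area) = (\<integral>\<^sup>+z. ennreal (F z) \<partial>disk_area)"
    unfolding F_def Y_def X_def using w by (intro nn_integral_disk_area_Moebius) auto
  also have "\<dots> \<le> (\<integral>\<^sup>+t. ennreal (2 * exp (- 2 * t) * exp (- t) powr (- s)) * indicator {0..} t \<partial>lborel)"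
  proof (rule nn_integral_disk_area_le_radial)
    fix \<rho> :: real assume \<rho>: "0 < \<rho>" "\<rho> < 1"
    define b where "b = - (cnj w * of_real \<rho>)"
    have b: "(cmod b)\<^sup>2 = X * \<rho>\<^sup>2" "cmod b < 1"
    proof -
      show "(cmod b)\<^sup>2 = X * \<rho>\<^sup>2"
        by (simp add: b_def norm_mult power_mult_distrib X_def)
      have "cmod w * \<rho> < 1 * 1" using w \<rho> by (intro mult_strict_mono') auto
      then show "cmod b < 1" using \<rho> by (simp add: b_def norm_mult)
    qed
    have F_le: "F (of_real \<rho> * cis \<theta>) \<le> \<rho> powr (- s) * (a * Y) * (1 / (cmod (1 - b * cis \<theta>))\<^sup>2) + \<rho> powr (- s) * (1 - a)" for \<theta>
    proof -
      define E where "E = (cmod (1 - b * cis \<theta>))\<^sup>2"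
      have d: "1 + cnj w * (of_real \<rho> * cis \<theta>) = 1 - b * cis \<theta>"
        by (simp add: b_def)
      have norm: "cmod (of_real \<rho> * cis \<theta>) = \<rho>" using \<rho> by (simp add: norm_mult)
      have "1 - b * cis \<theta> \<noteq> 0"
        using one_plus_cnj_mult_nonzero[of w "of_real \<rho> * cis \<theta>"] w \<rho> norm by (simp add: d)
      then have E: "0 < E" by (simp add: E_def)
      define y where "y = Y / E"
      have y: "0 < y" using E X by (simp add: y_def)
      have "F (of_real \<rho> * cis \<theta>) = Y\<^sup>2 / E\<^sup>2 * (E / (\<rho> * Y)) powr s"
        unfolding F_def E_def using w \<rho> norm
        by (subst cauchy_kernel_Moebius_left) (auto simp: d Y_def X_def norm_mult simp flip: power_mult)
      also have "\<dots> = y powr 2 * (inverse (\<rho> * y)) powr s"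
        using X E y by (simp add: y_def power_divide field_simps)
      also have "\<dots> = \<rho> powr (- s) * y powr a"
        using \<rho> y by (simp add: a_def powr_diff powr_minus powr_mult inverse_eq_divide powr_divide)
      also have "\<dots> \<le> \<rho> powr (- s) * (a * y + (1 - a))"
        using Youngs_inequality_0[of a "1 - a" y 1] a y by (intro mult_left_mono) auto
      finally show ?thesis
        by (simp add: y_def E_def algebra_simps)
    qed
    have \<beta>: "0 < 1 - X * \<rho>\<^sup>2"
      using b by (metis abs_square_less_1 abs_norm_cancel diff_gt_0_iff_gt)
    have "(\<integral>\<^sup>+\<theta>. ennreal (F (of_real \<rho> * cis \<theta>)) * indicator {- pi..pi} \<theta> \<partial>lborel)
      \<le> (\<integral>\<^sup>+\<theta>. ennreal (\<rho> powr (- s) * (a * Y)) * (ennreal (1 / (cmod (1 - b * cis \<theta>))\<^sup>2) * indicator {- pi..pi} \<theta>)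
          + ennreal (\<rho> powr (- s) * (1 - a)) * indicator {- pi..pi} \<theta> \<partial>lborel)"
    proof (intro nn_integral_mono)
      fix \<theta> :: real
      have "ennreal (F (of_real \<rho> * cis \<theta>)) \<le> ennreal (\<rho> powr (- s) * (a * Y) * (1 / (cmod (1 - b * cis \<theta>))\<^sup>2) + \<rho> powr (- s) * (1 - a))"
        by (intro ennreal_leI F_le)
      also have "\<dots> = ennreal (\<rho> powr (- s) * (a * Y)) * ennreal (1 / (cmod (1 - b * cis \<theta>))\<^sup>2) + ennreal (\<rho> powr (- s) * (1 - a))"
        using a X by (subst ennreal_plus, simp, simp, subst ennreal_mult) simp_all
      finally show "ennreal (F (of_real \<rho> * cis \<theta>)) * indicator {- pi..pi} \<theta>
        \<le> ennreal (\<rho> powr (- s) * (a * Y)) * (ennreal (1 / (cmod (1 - b * cis \<theta>))\<^sup>2) * indicator {- pi..pi} \<theta>)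
          + ennreal (\<rho> powr (- s) * (1 - a)) * indicator {- pi..pi} \<theta>"
        by (cases "\<theta> \<in> {- pi..pi}") (simp_all only: indicator_simps not_False_eq_True mult_1_right mult_zero_right order_refl add_0)
    qed
    also have "\<dots> = ennreal (\<rho> powr (- s) * (a * Y)) * ennreal (2 * pi / (1 - X * \<rho>\<^sup>2))
         + ennreal (\<rho> powr (- s) * (1 - a)) * ennreal (2 * pi)"
    proof (subst nn_integral_add)
      have "(\<integral>\<^sup>+\<theta>. ennreal (\<rho> powr (- s) * (a * Y)) * (ennreal (1 / (cmod (1 - b * cis \<theta>))\<^sup>2) * indicator {- pi..pi} \<theta>) \<partial>lborel)
        = ennreal (\<rho> powr (- s) * (a * Y)) * ennreal (2 * pi / (1 - X * \<rho>\<^sup>2))"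
        by (subst nn_integral_cmult, measurable) (simp only: nn_integral_circle_inverse_power2[OF b(2)] b(1))
      moreover have "(\<integral>\<^sup>+\<theta>. ennreal (\<rho> powr (- s) * (1 - a)) * indicator {- pi..pi} \<theta> \<partial>lborel)
        = ennreal (\<rho> powr (- s) * (1 - a)) * ennreal (2 * pi)"
        by (subst nn_integral_cmult_indicator) auto
      ultimately show "(\<integral>\<^sup>+\<theta>. ennreal (\<rho> powr (- s) * (a * Y)) * (ennreal (1 / (cmod (1 - b * cis \<theta>))\<^sup>2) * indicator {- pi..pi} \<theta>) \<partial>lborel)
        + (\<integral>\<^sup>+\<theta>. ennreal (\<rho> powr (- s) * (1 - a)) * indicator {- pi..pi} \<theta> \<partial>lborel)
        = ennreal (\<rho> powr (- s) * (a * Y)) * ennreal (2 * pi / (1 - X * \<rho>\<^sup>2))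
         + ennreal (\<rho> powr (- s) * (1 - a)) * ennreal (2 * pi)"
        by (simp only:)
    qed measurable
    also have "\<dots> = ennreal (\<rho> powr (- s) * (a * Y) * (2 * pi / (1 - X * \<rho>\<^sup>2)) + \<rho> powr (- s) * (1 - a) * (2 * pi))"
      using a X \<beta> by (simp flip: ennreal_mult ennreal_plus)
    also have "\<dots> \<le> ennreal (2 * pi * \<rho> powr (- s))"
    proof (rule ennreal_leI)
      have "X * \<rho>\<^sup>2 \<le> X * 1"
        using X \<rho> by (intro mult_left_mono) (auto intro: power_le_one)
      then have "Y / (1 - X * \<rho>\<^sup>2) \<le> 1"
        using \<beta> by (simp add: Y_def)
      then have "2 * pi * \<rho> powr (- s) * (a * (Y / (1 - X * \<rho>\<^sup>2)) + (1 - a)) \<le> 2 * pi * \<rho> powr (- s) * (a * 1 + (1 - a))"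
        using a by (intro mult_left_mono add_mono) auto
      then show "\<rho> powr (- s) * (a * Y) * (2 * pi / (1 - X * \<rho>\<^sup>2)) + \<rho> powr (- s) * (1 - a) * (2 * pi)
          \<le> 2 * pi * \<rho> powr (- s)"
        by (simp add: algebra_simps)
    qed
    finally show "(\<integral>\<^sup>+\<theta>. ennreal (F (of_real \<rho> * cis \<theta>)) * indicator {- pi..pi} \<theta> \<partial>lborel) \<le> ennreal (2 * pi * \<rho> powr (- s))" .
  qed (auto simp: F_def)
  also have "\<dots> = (\<integral>\<^sup>+t. ennreal (2 * exp (- (a * t))) * indicator {0..} t \<partial>lborel)"
    by (intro nn_integral_cong) (simp add: a_def powr_def algebra_simps flip: exp_add)
  also have "\<dots> = ennreal (0 - (- (2 / a) * exp (- (a * 0))))"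
  proof (rule nn_integral_FTC_atLeast)
    show "((\<lambda>t. - (2 / a) * exp (- (a * t))) has_real_derivative 2 * exp (- (a * t))) (at t)" for t
      using a by (auto intro!: derivative_eq_intros)
    show "((\<lambda>t. - (2 / a) * exp (- (a * t))) \<longlongrightarrow> 0) at_top"
      using a by real_asymp
  qed auto
  finally show ?thesis by (simp add: a_def)
qed


text \<open>
  Write \<open>a = 2 - s\<close>, \<open>X = |z|\<^sup>2\<close>, \<open>Y = 1 - X\<close>. After the Moebius substitution the integrand
  is \<open>Y powr a * |w| powr (- s) * (1 - |w|\<^sup>2) powr s / |1 + cnj z * w| ^ 4\<close>. Replacing
  \<open>1 - |w|\<^sup>2\<close> by the larger \<open>1 - X |w|\<^sup>2\<close> makes the radial integral explicit: with \<open>u = \<rho>\<^sup>2\<close> the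
  circular means then give, up to the prefactor \<open>Y powr a\<close>,
  \<open>u powr (a/2 - 1) * (1 + X u) * (1 - X u) powr (- a - 1)\<close>, which is the derivative of
  \<open>(2 / a) * u powr (a/2) * (1 - X u) powr (- a)\<close>. Its value at \<open>u = 1\<close> is
  \<open>(2 / a) * Y powr (- a)\<close>, which the prefactor cancels to \<open>2 / a\<close>.
\<close>

lemma nn_integral_cauchy_kernel_right:
  assumes z: "z \<in> unit_disk" and s: "0 < s" "s < 2"
  shows "(\<integral>\<^sup>+w. ennreal (cmod (cauchy_kernel z w) powr s) \<partial>disk_area) \<le> ennreal (2 / (2 - s))"
proof -
  define a where "a = 2 - s"
  have a: "0 < a" using s by (auto simp: a_def)
  define X where "X = (cmod z)\<^sup>2"
  define Y where "Y = 1 - X"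
  have X: "0 \<le> X" "0 < Y" using z by (auto simp: X_def Y_def abs_square_less_1)
  have X_less: "X * u < 1" if "u \<le> 1" for u
  proof -
    have "X * u \<le> X * 1" using that X by (intro mult_left_mono) auto
    then show ?thesis using X by (simp add: Y_def)
  qed
  define F where "F = (\<lambda>w. Y\<^sup>2 / cmod (1 + cnj z * w) ^ 4
          * cmod (cauchy_kernel z ((w + z) / (1 + cnj z * w))) powr s)"
  define G where "G = (\<lambda>\<rho>. Y powr a * \<rho> powr (- s) * (1 + X * \<rho>\<^sup>2) * (1 - X * \<rho>\<^sup>2) powr (- a - 1))"
  have "(\<integral>\<^sup>+w. ennreal (cmod (cauchy_kernel z w) powr s) \<partial>disk_area) = (\<integral>\<^sup>+w. ennreal (F w) \<partial>disk_area)"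
    unfolding F_def Y_def X_def using z by (intro nn_integral_disk_area_Moebius) auto
  also have "\<dots> \<le> (\<integral>\<^sup>+t. ennreal (2 * exp (- 2 * t) * G (exp (- t))) * indicator {0..} t \<partial>lborel)"
  proof (rule nn_integral_disk_area_le_radial)
    fix \<rho> :: real assume \<rho>: "0 < \<rho>" "\<rho> < 1"
    define b where "b = - (cnj z * of_real \<rho>)"
    have b: "(cmod b)\<^sup>2 = X * \<rho>\<^sup>2" "cmod b < 1"
    proof -
      show "(cmod b)\<^sup>2 = X * \<rho>\<^sup>2"
        by (simp add: b_def norm_mult power_mult_distrib X_def)
      have "cmod z * \<rho> < 1 * 1" using z \<rho> by (intro mult_strict_mono') auto
      then show "cmod b < 1" using \<rho> by (simp add: b_def norm_mult)
    qed
    have sq: "\<rho>\<^sup>2 \<le> 1" "\<rho>\<^sup>2 < 1" using \<rho> by (auto simp: power_le_one abs_square_less_1)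
    have \<beta>: "0 < 1 - X * \<rho>\<^sup>2" using X_less[OF sq(1)] by simp
    define H where "H = Y powr a * \<rho> powr (- s) * (1 - X * \<rho>\<^sup>2) powr s"
    have F_le: "F (of_real \<rho> * cis \<theta>) \<le> H * (1 / cmod (1 - b * cis \<theta>) ^ 4)" for \<theta>
    proof -
      have d: "1 + cnj z * (of_real \<rho> * cis \<theta>) = 1 - b * cis \<theta>"
        by (simp add: b_def)
      have norm: "cmod (of_real \<rho> * cis \<theta>) = \<rho>" using \<rho> by (simp add: norm_mult)
      have "F (of_real \<rho> * cis \<theta>) = Y\<^sup>2 / cmod (1 - b * cis \<theta>) ^ 4 * ((1 - \<rho>\<^sup>2) / (\<rho> * Y)) powr s"
        unfolding F_def using z \<rho> norm
        by (subst cauchy_kernel_Moebius_right) (auto simp: d Y_def X_def norm_mult)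
      also have "\<dots> \<le> Y\<^sup>2 / cmod (1 - b * cis \<theta>) ^ 4 * ((1 - X * \<rho>\<^sup>2) / (\<rho> * Y)) powr s"
      proof (intro mult_left_mono powr_mono2 divide_right_mono)
        have "X * \<rho>\<^sup>2 \<le> 1 * \<rho>\<^sup>2" using X by (intro mult_right_mono) (auto simp: Y_def)
        then show "1 - \<rho>\<^sup>2 \<le> 1 - X * \<rho>\<^sup>2" by simp
      qed (use s sq \<rho> X in auto)
      also have "((1 - X * \<rho>\<^sup>2) / (\<rho> * Y)) powr s = (1 - X * \<rho>\<^sup>2) powr s * \<rho> powr (- s) * Y powr (- s)"
        using \<rho> X \<beta> by (simp add: powr_divide powr_mult powr_minus field_simps)
      also have "Y\<^sup>2 / cmod (1 - b * cis \<theta>) ^ 4 * ((1 - X * \<rho>\<^sup>2) powr s * \<rho> powr (- s) * Y powr (- s))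
          = H * (1 / cmod (1 - b * cis \<theta>) ^ 4)"
        using X by (simp add: H_def a_def powr_diff powr_minus field_simps)
      finally show ?thesis .
    qed
    have H: "0 \<le> H" by (simp add: H_def)
    have "(\<integral>\<^sup>+\<theta>. ennreal (F (of_real \<rho> * cis \<theta>)) * indicator {- pi..pi} \<theta> \<partial>lborel)
      \<le> (\<integral>\<^sup>+\<theta>. ennreal H * (ennreal (1 / cmod (1 - b * cis \<theta>) ^ 4) * indicator {- pi..pi} \<theta>) \<partial>lborel)"
    proof (intro nn_integral_mono)
      fix \<theta> :: real
      have "ennreal (F (of_real \<rho> * cis \<theta>)) \<le> ennreal (H * (1 / cmod (1 - b * cis \<theta>) ^ 4))"
        by (intro ennreal_leI F_le)
      also have "\<dots> = ennreal H * ennreal (1 / cmod (1 - b * cis \<theta>) ^ 4)"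
        using H by (intro ennreal_mult) simp_all
      finally show "ennreal (F (of_real \<rho> * cis \<theta>)) * indicator {- pi..pi} \<theta>
        \<le> ennreal H * (ennreal (1 / cmod (1 - b * cis \<theta>) ^ 4) * indicator {- pi..pi} \<theta>)"
        by (cases "\<theta> \<in> {- pi..pi}") (simp_all only: indicator_simps not_False_eq_True mult_1_right mult_zero_right order_refl)
    qed
    also have "\<dots> = ennreal H * ennreal (2 * pi * (1 + X * \<rho>\<^sup>2) / (1 - X * \<rho>\<^sup>2) ^ 3)"
      by (subst nn_integral_cmult, measurable) (simp only: nn_integral_circle_inverse_power4[OF b(2)] b(1))
    also have "\<dots> = ennreal (H * (2 * pi * (1 + X * \<rho>\<^sup>2) / (1 - X * \<rho>\<^sup>2) ^ 3))"
      using H X \<beta> by (simp flip: ennreal_mult)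
    also have "H * (2 * pi * (1 + X * \<rho>\<^sup>2) / (1 - X * \<rho>\<^sup>2) ^ 3) = 2 * pi * G \<rho>"
    proof -
      have "(1 - X * \<rho>\<^sup>2) powr s / (1 - X * \<rho>\<^sup>2) ^ 3 = (1 - X * \<rho>\<^sup>2) powr (s - 3)"
        using \<beta> by (simp add: powr_diff)
      moreover have "H * (2 * pi * (1 + X * \<rho>\<^sup>2) / (1 - X * \<rho>\<^sup>2) ^ 3)
          = 2 * pi * (Y powr a * \<rho> powr (- s) * (1 + X * \<rho>\<^sup>2)) * ((1 - X * \<rho>\<^sup>2) powr s / (1 - X * \<rho>\<^sup>2) ^ 3)"
        by (simp add: H_def)
      ultimately show ?thesis by (simp add: G_def a_def)
    qed
    finally show "(\<integral>\<^sup>+\<theta>. ennreal (F (of_real \<rho> * cis \<theta>)) * indicator {- pi..pi} \<theta> \<partial>lborel) \<le> ennreal (2 * pi * G \<rho>)" .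
  qed (use X in \<open>auto simp: F_def G_def\<close>)
  also have "\<dots> = ennreal (0 - (- (2 / a) * Y powr a * exp (- (a * 0)) * (1 - X * exp (- 2 * 0)) powr (- a)))"
  proof (rule nn_integral_FTC_atLeast)
    fix t :: real assume t: "0 \<le> t"
    have pos: "0 < 1 - X * exp (- 2 * t)" using X_less[of "exp (- 2 * t)"] t by simp
    have "((\<lambda>t. - (2 / a) * Y powr a * exp (- (a * t)) * (1 - X * exp (- 2 * t)) powr (- a)) has_real_derivative
        2 * Y powr a * exp (- (a * t)) * ((1 - X * exp (- 2 * t)) powr (- a)
          + 2 * X * exp (- 2 * t) * (1 - X * exp (- 2 * t)) powr (- a - 1))) (at t)"
      using a pos by (auto intro!: derivative_eq_intros simp: field_simps)
    also have "(1 - X * exp (- 2 * t)) powr (- a) = (1 - X * exp (- 2 * t)) * (1 - X * exp (- 2 * t)) powr (- a - 1)"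
      using pos by (simp add: powr_mult_base)
    also have "2 * Y powr a * exp (- (a * t)) * ((1 - X * exp (- 2 * t)) * (1 - X * exp (- 2 * t)) powr (- a - 1)
          + 2 * X * exp (- 2 * t) * (1 - X * exp (- 2 * t)) powr (- a - 1))
        = 2 * (exp (- 2 * t) * exp (s * t)) * Y powr a * (1 + X * exp (- 2 * t)) * (1 - X * exp (- 2 * t)) powr (- a - 1)"
      by (simp add: a_def algebra_simps flip: exp_add)
    also have "\<dots> = 2 * exp (- 2 * t) * G (exp (- t))"
      by (simp add: G_def powr_def[of "exp _"] mult_ac power2_eq_square flip: exp_add)
    finally show "((\<lambda>t. - (2 / a) * Y powr a * exp (- (a * t)) * (1 - X * exp (- 2 * t)) powr (- a)) has_real_derivative
        2 * exp (- 2 * t) * G (exp (- t))) (at t)" .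
    show "0 \<le> 2 * exp (- 2 * t) * G (exp (- t))"
      using X by (simp add: G_def)
  next
    show "((\<lambda>t. - (2 / a) * Y powr a * exp (- (a * t)) * (1 - X * exp (- 2 * t)) powr (- a)) \<longlongrightarrow> 0) at_top"
      using a by real_asymp
  qed (auto simp: G_def)
  also have "0 - (- (2 / a) * Y powr a * exp (- (a * 0)) * (1 - X * exp (- 2 * 0)) powr (- a)) = 2 / (2 - s)"
  proof -
    have "Y powr a * Y powr (- a) = 1"
      using X by (simp flip: powr_add)
    then show ?thesis by (simp add: a_def flip: Y_def)
  qed
  finally show ?thesis .
qed

section \<open>Integral operators from \<open>L\<^sup>p\<close> to its dual exponent\<close>

text \<open>
  Young's inequality for the weights \<open>2 / q\<close> and \<open>1 - 2 / q\<close>, applied to \<open>sqrt (u v)\<close> and \<open>w\<close>.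
\<close>

lemma geometric_mean3_le:
  fixes u v w q :: real
  assumes "0 \<le> u" "0 \<le> v" "0 \<le> w" "2 < q"
  shows "u powr (1 / q) * v powr (1 / q) * w powr (1 - 2 / q) \<le> u / q + v / q + (1 - 2 / q) * w"
proof (cases "u = 0 \<or> v = 0 \<or> w = 0")
  case True
  moreover have "0 \<le> 1 - 2 / q" using assms by simp
  ultimately show ?thesis using assms by auto
next
  case False
  then have pos: "0 < u" "0 < v" "0 < w" using assms by auto
  have "u powr (1 / q) * v powr (1 / q) = (sqrt (u * v)) powr (2 / q)"
    using pos by (simp add: powr_half_sqrt[symmetric] powr_powr powr_mult)
  also have "\<dots> * w powr (1 - 2 / q) \<le> 2 / q * sqrt (u * v) + (1 - 2 / q) * w"
    using pos assms by (intro Youngs_inequality_0) auto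
  also have "2 / q * sqrt (u * v) \<le> 2 / q * ((u + v) / 2)"
    using pos assms arith_geo_mean_sqrt[of u v] by (intro mult_left_mono) auto
  finally show ?thesis using assms by (simp add: field_simps)
qed

text \<open>
  Hoelder's inequality for three factors with exponents \<open>1 / q\<close>, \<open>1 / q\<close>, \<open>1 - 2 / q\<close>, based on
  the splitting
  \<open>k h = (k powr (q/2) * h powr p) powr (1/q) * (k powr (q/2)) powr (1/q) * (h powr p) powr (1 - 2/q)\<close>;
  the powers of \<open>h\<close> match because \<open>p\<close> and \<open>q\<close> are conjugate. Normalizing each factor by (a
  bound for) its integral reduces this to the inequality between weighted means.
\<close>

lemma nn_integral_kernel_Hoelder:
  fixes k h :: "'a \<Rightarrow> real" and p q :: real
  assumes [measurable]: "k \<in> borel_measurable M" "h \<in> borel_measurable M"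
    and nonneg: "\<And>x. 0 \<le> k x" "\<And>x. 0 \<le> h x"
    and q: "2 < q" "q = p / (p - 1)" "1 < p"
    and K: "(\<integral>\<^sup>+x. ennreal (k x powr (q / 2)) \<partial>M) \<le> ennreal B" "0 < B"
    and N: "(\<integral>\<^sup>+x. ennreal (h x powr p) \<partial>M) \<le> ennreal N" "0 < N"
    and A: "(\<integral>\<^sup>+x. ennreal (k x powr (q / 2) * h x powr p) \<partial>M) = ennreal A" "0 \<le> A"
  shows "(\<integral>\<^sup>+x. ennreal (k x * h x) \<partial>M) \<le> ennreal (A powr (1 / q) * B powr (1 / q) * N powr (1 - 2 / q))"
proof (cases "A = 0")
  case True
  then have "AE x in M. ennreal (k x powr (q / 2) * h x powr p) = 0"
    using A by (simp add: nn_integral_0_iff_AE)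
  then have "AE x in M. ennreal (k x * h x) = 0"
    by eventually_elim (use nonneg in \<open>auto simp: ennreal_eq_0_iff mult_le_0_iff\<close>)
  then show ?thesis
    by (simp add: nn_integral_0_iff_AE[THEN iffD2])
next
  case False
  then have pos: "0 < A" using A by simp
  have "1 / q = (p - 1) / p"
    by (simp add: q(2))
  then have "1 / q = 1 - 1 / p"
    using q(3) by (simp add: diff_divide_distrib)
  moreover have "1 / q + (1 - 2 / q) = 1 - 1 / q"
    using q(1) by (simp add: field_simps)
  ultimately have "1 / q + (1 - 2 / q) = 1 / p"
    by linarith
  then have p_q: "p * (1 / q + (1 - 2 / q)) = 1"
    using q(3) by simp
  define C where "C = A powr (1 / q) * B powr (1 / q) * N powr (1 - 2 / q)"
  have C: "0 < C" using pos K N by (simp add: C_def)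
  have pointwise: "k x * h x \<le> C / (q * A) * (k x powr (q / 2) * h x powr p)
      + C / (q * B) * (k x powr (q / 2)) + C * (1 - 2 / q) / N * (h x powr p)" for x
  proof -
    let ?u = "k x powr (q / 2) * h x powr p / A" and ?v = "k x powr (q / 2) / B" and ?w = "h x powr p / N"
    have "k x = k x powr (1 / 2) * k x powr (1 / 2)"
      using nonneg(1)[of x] by (simp add: powr_half_sqrt)
    moreover have "h x = h x powr (p * (1 / q)) * h x powr (p * (1 - 2 / q))"
      unfolding powr_add[symmetric] distrib_left[symmetric] p_q using nonneg by simp
    ultimately have "k x * h x = C * (?u powr (1 / q) * ?v powr (1 / q) * ?w powr (1 - 2 / q))"
      using pos K N q(1) nonneg by (simp add: C_def powr_mult powr_divide powr_powr mult_ac)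
    also have "\<dots> \<le> C * (?u / q + ?v / q + (1 - 2 / q) * ?w)"
      using C pos K N q by (intro mult_left_mono geometric_mean3_le) auto
    finally show ?thesis
      by (simp add: distrib_left mult_ac)
  qed
  have coeffs: "0 \<le> C / (q * A)" "0 \<le> C / (q * B)" "0 \<le> C * (1 - 2 / q) / N"
    using C pos K N q(1) by auto
  have "(\<integral>\<^sup>+x. ennreal (k x * h x) \<partial>M)
    \<le> (\<integral>\<^sup>+x. ennreal (C / (q * A)) * ennreal (k x powr (q / 2) * h x powr p)
      + ennreal (C / (q * B)) * ennreal (k x powr (q / 2)) + ennreal (C * (1 - 2 / q) / N) * ennreal (h x powr p) \<partial>M)"
  proof (intro nn_integral_mono)
    fix x
    show "ennreal (k x * h x) \<le> ennreal (C / (q * A)) * ennreal (k x powr (q / 2) * h x powr p)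
      + ennreal (C / (q * B)) * ennreal (k x powr (q / 2)) + ennreal (C * (1 - 2 / q) / N) * ennreal (h x powr p)"
      using ennreal_leI[OF pointwise[of x]] coeffs
      by (simp only: ennreal_plus ennreal_mult add_nonneg_nonneg mult_nonneg_nonneg powr_ge_zero)
  qed
  also have "\<dots> = ennreal (C / (q * A)) * (\<integral>\<^sup>+x. ennreal (k x powr (q / 2) * h x powr p) \<partial>M)
      + ennreal (C / (q * B)) * (\<integral>\<^sup>+x. ennreal (k x powr (q / 2)) \<partial>M)
      + ennreal (C * (1 - 2 / q) / N) * (\<integral>\<^sup>+x. ennreal (h x powr p) \<partial>M)"
    by (simp add: nn_integral_add nn_integral_cmult)
  also have "\<dots> \<le> ennreal (C / (q * A)) * ennreal A + ennreal (C / (q * B)) * ennreal B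
      + ennreal (C * (1 - 2 / q) / N) * ennreal N"
    using K N A by (intro add_mono mult_left_mono) auto
  also have "\<dots> = ennreal (C / q + C / q + C * (1 - 2 / q))"
    using C pos K N q(1) by (simp flip: ennreal_mult ennreal_plus)
  also have "C / q + C / q + C * (1 - 2 / q) = C"
    using q(1) by (simp add: field_simps)
  finally show ?thesis by (simp add: C_def)
qed

text \<open>
  Young's inequality for integral operators with a kernel bounded in \<open>L\<^sup>r\<close> in each variable,
  \<open>1 + 1/q = 1/p + 1/r\<close>. For conjugate \<open>p\<close> and \<open>q\<close> this forces \<open>r = q / 2\<close>. The pointwise Hoelder
  bound is raised to the power \<open>q\<close> and integrated; Tonelli's theorem then lets the second
  bound on the kernel act. The operator norm to the power \<open>q\<close> is at most \<open>B B'\<close>.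
\<close>

lemma nn_integral_kernel_Young:
  fixes k :: "'a \<Rightarrow> 'b \<Rightarrow> real" and h :: "'b \<Rightarrow> real" and p q :: real
  assumes "sigma_finite_measure M" "sigma_finite_measure M'"
    and k [measurable]: "case_prod k \<in> borel_measurable (M \<Otimes>\<^sub>M M')"
    and [measurable]: "h \<in> borel_measurable M'"
    and nonneg: "\<And>x y. 0 \<le> k x y" "\<And>y. 0 \<le> h y"
    and q: "2 < q" "q = p / (p - 1)" "1 < p"
    and B: "\<And>x. x \<in> space M \<Longrightarrow> (\<integral>\<^sup>+y. ennreal (k x y powr (q / 2)) \<partial>M') \<le> ennreal B" "0 < B"
    and B': "\<And>y. y \<in> space M' \<Longrightarrow> (\<integral>\<^sup>+x. ennreal (k x y powr (q / 2)) \<partial>M) \<le> ennreal B'" "0 \<le> B'"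
    and N: "(\<integral>\<^sup>+y. ennreal (h y powr p) \<partial>M') \<le> ennreal N" "0 < N"
  shows "AE x in M. (\<integral>\<^sup>+y. ennreal (k x y * h y) \<partial>M') < \<infinity>"
    and "(\<integral>\<^sup>+x. ennreal (enn2real (\<integral>\<^sup>+y. ennreal (k x y * h y) \<partial>M') powr q) \<partial>M)
      \<le> ennreal (B * B' * N powr (q - 1))"
proof -
  interpret M: sigma_finite_measure M by fact
  interpret M': sigma_finite_measure M' by fact
  interpret pair_sigma_finite M M' ..
  define I where "I = (\<lambda>x. \<integral>\<^sup>+y. ennreal (k x y * h y) \<partial>M')"
  define A where "A = (\<lambda>x. \<integral>\<^sup>+y. ennreal (k x y powr (q / 2) * h y powr p) \<partial>M')"
  have [measurable]: "A \<in> borel_measurable M"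
    unfolding A_def by measurable
  have "(\<integral>\<^sup>+x. A x \<partial>M) = (\<integral>\<^sup>+y. (\<integral>\<^sup>+x. ennreal (k x y powr (q / 2) * h y powr p) \<partial>M) \<partial>M')"
    unfolding A_def by (rule Fubini'[symmetric]) measurable
  also have "\<dots> \<le> (\<integral>\<^sup>+y. ennreal B' * ennreal (h y powr p) \<partial>M')"
  proof (rule nn_integral_mono)
    fix y assume y: "y \<in> space M'"
    have "(\<integral>\<^sup>+x. ennreal (k x y powr (q / 2) * h y powr p) \<partial>M)
      = (\<integral>\<^sup>+x. ennreal (k x y powr (q / 2)) \<partial>M) * ennreal (h y powr p)"
      using y by (simp add: ennreal_mult nn_integral_multc)
    then show "(\<integral>\<^sup>+x. ennreal (k x y powr (q / 2) * h y powr p) \<partial>M) \<le> ennreal B' * ennreal (h y powr p)"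
      using B'(1)[OF y] by (simp add: mult_right_mono)
  qed
  also have "\<dots> = ennreal B' * (\<integral>\<^sup>+y. ennreal (h y powr p) \<partial>M')"
    by (rule nn_integral_cmult) measurable
  also have "\<dots> \<le> ennreal B' * ennreal N"
    using N by (intro mult_left_mono) auto
  finally have A_le: "(\<integral>\<^sup>+x. A x \<partial>M) \<le> ennreal B' * ennreal N" .
  have I_le: "I x < \<infinity>" "ennreal (enn2real (I x) powr q) \<le> ennreal (B * N powr (q - 2)) * A x"
    if x: "x \<in> space M" and fin: "A x < \<infinity>" for x
  proof -
    obtain a where a: "A x = ennreal a" "0 \<le> a"
      using fin by (cases "A x") auto
    have le: "I x \<le> ennreal (a powr (1 / q) * B powr (1 / q) * N powr (1 - 2 / q))"
      unfolding I_def
      by (rule nn_integral_kernel_Hoelder[where p = p]) (use x nonneg q B N a in \<open>auto simp: A_def\<close>)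
    then show fin: "I x < \<infinity>"
      by (rule order_le_less_trans) simp
    have "enn2real (I x) \<le> a powr (1 / q) * B powr (1 / q) * N powr (1 - 2 / q)"
      using le by (intro enn2real_leI) auto
    then have "enn2real (I x) powr q \<le> (a powr (1 / q) * B powr (1 / q) * N powr (1 - 2 / q)) powr q"
      using q by (intro powr_mono2) auto
    also have "\<dots> = B * N powr (q - 2) * a"
    proof -
      have "q * (1 - 2 / q) = q - 2" using q(1) by (simp add: field_simps)
      then show ?thesis using a B N q(1) by (simp add: powr_mult powr_powr mult_ac)
    qed
    finally show "ennreal (enn2real (I x) powr q) \<le> ennreal (B * N powr (q - 2)) * A x"
      using a B by (simp add: ennreal_leI flip: ennreal_mult)
  qed
  have "(\<integral>\<^sup>+x. A x \<partial>M) < \<infinity>"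
    using A_le by (rule order_le_less_trans) (simp add: ennreal_mult_less_top)
  then have AE_A: "AE x in M. A x < \<infinity>"
    using nn_integral_PInf_AE[of A M] by (auto simp: top.not_eq_extremum)
  have AE: "AE x in M. I x < \<infinity> \<and> ennreal (enn2real (I x) powr q) \<le> ennreal (B * N powr (q - 2)) * A x"
    using AE_A AE_space by eventually_elim (use I_le in auto)
  then show "AE x in M. (\<integral>\<^sup>+y. ennreal (k x y * h y) \<partial>M') < \<infinity>"
    by (auto simp: I_def elim: eventually_mono)
  have "(\<integral>\<^sup>+x. ennreal (enn2real (I x) powr q) \<partial>M) \<le> (\<integral>\<^sup>+x. ennreal (B * N powr (q - 2)) * A x \<partial>M)"
    using AE by (intro nn_integral_mono_AE) (auto elim: eventually_mono)
  also have "\<dots> = ennreal (B * N powr (q - 2)) * (\<integral>\<^sup>+x. A x \<partial>M)"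
    by (rule nn_integral_cmult) measurable
  also have "\<dots> \<le> ennreal (B * N powr (q - 2)) * (ennreal B' * ennreal N)"
    by (intro mult_left_mono A_le) auto
  also have "\<dots> = ennreal (B * B' * (N * N powr (q - 2)))"
    using B B' N by (simp add: mult_ac flip: ennreal_mult)
  also have "N * N powr (q - 2) = N powr (q - 1)"
    using N by (simp add: powr_mult_base)
  finally show "(\<integral>\<^sup>+x. ennreal (enn2real (\<integral>\<^sup>+y. ennreal (k x y * h y) \<partial>M') powr q) \<partial>M)
      \<le> ennreal (B * B' * N powr (q - 1))"
    by (simp add: I_def)
qed

section \<open>The Cauchy transform\<close>

lemma finite_measure_disk_area: "finite_measure disk_area"
proof
  have "emeasure disk_area (space disk_area) = (\<integral>\<^sup>+z. 1 \<partial>disk_area)"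
    by simp
  also have "\<dots> = ennreal (1 / pi) * emeasure lborel unit_disk"
    by (subst nn_integral_disk_area) simp_all
  also have "\<dots> < \<infinity>"
    using emeasure_bounded_finite[of unit_disk] by (simp add: ennreal_mult_less_top)
  finally show "emeasure disk_area (space disk_area) \<noteq> \<infinity>" by simp
qed

lemma measurable_disk_area_borel: "(\<lambda>z. z) \<in> disk_area \<rightarrow>\<^sub>M borel"
  unfolding disk_area_def
  by (auto intro!: measurable_restrict_space1 measurable_completion)

text \<open>
  Both kernel bounds with \<open>s = q / 2\<close> equal \<open>2 / (2 - q / 2) = 4 / (4 - q)\<close>. The Lebesgue integral
  in the definition of the transform vanishes where it diverges, so the pointwise comparison with
  the integral of the absolute values holds at every point of the disk.
\<close>

lemma cauchy_transform_bound:
  fixes p q N :: real and g :: "complex \<Rightarrow> complex"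
  assumes p: "3 / 2 < p" "p < 2" and q: "q = p / (p - 1)"
    and g [measurable]: "g \<in> borel_measurable disk_area"
    and N: "(\<integral>\<^sup>+z. ennreal (cmod (g z) powr p) \<partial>disk_area) \<le> ennreal N" "0 < N"
  shows "AE z in disk_area. integrable disk_area (\<lambda>w. cauchy_kernel z w * g w)"
    and "cauchy_transform g \<in> borel_measurable disk_area"
    and "(\<integral>\<^sup>+z. ennreal (cmod (cauchy_transform g z) powr q) \<partial>disk_area)
      \<le> ennreal ((4 / (4 - q))\<^sup>2 * N powr (q - 1))"
proof -
  interpret finite_measure disk_area by (rule finite_measure_disk_area)
  note measurable_disk_area_borel [measurable]
  have [measurable]: "case_prod cauchy_kernel \<in> borel_measurable (disk_area \<Otimes>\<^sub>M disk_area)"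
    unfolding case_prod_unfold by measurable
  have q_bounds: "2 < q" "q < 3"
    using p by (auto simp: q field_simps)
  define I where "I = (\<lambda>z. \<integral>\<^sup>+w. ennreal (cmod (cauchy_kernel z w) * cmod (g w)) \<partial>disk_area)"
  define B where "B = 4 / (4 - q)"
  have B: "0 < B" "2 / (2 - q / 2) = B"
    using q_bounds by (auto simp: B_def field_simps)
  have right: "(\<integral>\<^sup>+w. ennreal (cmod (cauchy_kernel z w) powr (q / 2)) \<partial>disk_area) \<le> ennreal B"
    if "z \<in> space disk_area" for z
    using nn_integral_cauchy_kernel_right[of z "q / 2"] that q_bounds B by (simp add: space_disk_area)
  have left: "(\<integral>\<^sup>+z. ennreal (cmod (cauchy_kernel z w) powr (q / 2)) \<partial>disk_area) \<le> ennreal B"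
    if "w \<in> space disk_area" for w
    using nn_integral_cauchy_kernel_left[of w "q / 2"] that q_bounds B by (simp add: space_disk_area)
  have "1 < p" using p by simp
  note young = nn_integral_kernel_Young[where k = "\<lambda>z w. cmod (cauchy_kernel z w)" and h = "\<lambda>w. cmod (g w)",
      OF sigma_finite_measure_axioms sigma_finite_measure_axioms _ _ norm_ge_zero norm_ge_zero
        q_bounds(1) q \<open>1 < p\<close> right B(1) left less_imp_le[OF B(1)] N]
  have *: "AE z in disk_area. I z < \<infinity>"
    "(\<integral>\<^sup>+z. ennreal (enn2real (I z) powr q) \<partial>disk_area) \<le> ennreal (B * B * N powr (q - 1))"
    unfolding I_def by (intro young; measurable)+
  have integrable_iff: "integrable disk_area (\<lambda>w. cauchy_kernel z w * g w) \<longleftrightarrow> I z < \<infinity>" if "z \<in> space disk_area" for z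
    using that by (simp add: integrable_iff_bounded I_def norm_mult)
  show "AE z in disk_area. integrable disk_area (\<lambda>w. cauchy_kernel z w * g w)"
    using *(1) AE_space by eventually_elim (simp add: integrable_iff)
  show "cauchy_transform g \<in> borel_measurable disk_area"
    unfolding cauchy_transform_def[abs_def]
    by (intro borel_measurable_lebesgue_integral) measurable
  have "cmod (cauchy_transform g z) \<le> enn2real (I z)" if z: "z \<in> space disk_area" for z
  proof (cases "integrable disk_area (\<lambda>w. cauchy_kernel z w * g w)")
    case True
    then have "ennreal (cmod (cauchy_transform g z)) \<le> I z"
      unfolding cauchy_transform_def I_def norm_mult[symmetric]
      by (rule integral_norm_bound_ennreal)
    then show ?thesis
      using True z enn2real_mono[of "ennreal (cmod (cauchy_transform g z))" "I z"] by (simp add: integrable_iff)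
  next
    case False
    then show ?thesis by (simp add: cauchy_transform_def not_integrable_integral_eq)
  qed
  then have "(\<integral>\<^sup>+z. ennreal (cmod (cauchy_transform g z) powr q) \<partial>disk_area)
      \<le> (\<integral>\<^sup>+z. ennreal (enn2real (I z) powr q) \<partial>disk_area)"
    using q_bounds by (intro nn_integral_mono ennreal_leI powr_mono2) auto
  with *(2) show "(\<integral>\<^sup>+z. ennreal (cmod (cauchy_transform g z) powr q) \<partial>disk_area)
      \<le> ennreal ((4 / (4 - q))\<^sup>2 * N powr (q - 1))"
    by (simp add: power2_eq_square B_def)
qed

section \<open>Extended norms and the constant\<close>

lemma enn_powr_mono: "0 \<le> s \<Longrightarrow> x \<le> y \<Longrightarrow> enn_powr x s \<le> enn_powr y s"
  by (auto simp: enn_powr_def top_unique intro!: ennreal_leI powr_mono2 enn2real_mono)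
     (simp add: top.not_eq_extremum)

lemma enn_powr_ennreal: "0 \<le> x \<Longrightarrow> enn_powr (ennreal x) s = ennreal (x powr s)"
  by (simp add: enn_powr_def)

lemma enn_powr_eq_1_iff: "s \<noteq> 0 \<Longrightarrow> enn_powr x s = 1 \<longleftrightarrow> x = 1"
  by (cases x) (auto simp: enn_powr_def powr_def split: if_splits)

lemma enn_powr_less_top_iff: "enn_powr x s < top \<longleftrightarrow> x < top"
  by (auto simp: enn_powr_def top.not_eq_extremum)

text \<open>
  With \<open>x = 3 - q\<close> the claim without the Gamma term is \<open>16 x \<le> 4 sqrt 2 * (1 + x)\<^sup>2\<close>, which
  follows from \<open>4 x \<le> (1 + x)\<^sup>2\<close>.
\<close>

lemma squared_kernel_bound_le:
  fixes q :: real
  assumes "2 < q" "q < 3"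
  shows "(4 / (4 - q))\<^sup>2 \<le> 2 powr (3 / 2) * (2 / (3 - q) + 1 / Gamma (3 - q))"
proof -
  define x where "x = 3 - q"
  have x: "0 < x" "x < 1" using assms by (auto simp: x_def)
  have powr: "2 powr (3 / 2) = 2 * sqrt (2::real)"
  proof -
    have "2 powr (3 / 2) = (2::real) powr (1 + 1 / 2)" by simp
    also have "\<dots> = 2 * sqrt 2" unfolding powr_add by (simp add: powr_half_sqrt)
    finally show ?thesis .
  qed
  have "16 * x \<le> 4 * sqrt 2 * (1 + x)\<^sup>2"
  proof -
    have "0 \<le> (1 - x)\<^sup>2" by simp
    then have "4 * x \<le> (1 + x)\<^sup>2" by (simp add: power2_eq_square algebra_simps)
    moreover have "1 * (1 + x)\<^sup>2 \<le> sqrt 2 * (1 + x)\<^sup>2" by (intro mult_right_mono) auto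
    ultimately show ?thesis by simp
  qed
  then have "16 / (1 + x)\<^sup>2 \<le> 4 * sqrt 2 / x"
    using x by (simp add: pos_le_divide_eq pos_divide_le_eq)
  moreover have "(4 / (4 - q))\<^sup>2 = 16 / (1 + x)\<^sup>2"
    by (simp add: x_def power_divide)
  ultimately have "(4 / (4 - q))\<^sup>2 \<le> 2 powr (3 / 2) * (2 / x)"
    by (simp add: powr)
  also have "\<dots> \<le> 2 powr (3 / 2) * (2 / x + 1 / Gamma x)"
    using x by (intro mult_left_mono) (auto simp: Gamma_real_pos less_imp_le)
  finally show ?thesis by (simp add: x_def)
qed

theorem theorem1p1:
  fixes p q :: real
  assumes "3 / 2 < p" "p < 2"
    and "q = p / (p - 1)"
  shows "(\<forall>g \<in> Lp_disk p.
            (AE z in disk_area. integrable disk_area (\<lambda>w. cauchy_kernel z w * g w)) \<and>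
            cauchy_transform g \<in> Lp_disk q) \<and>
         enn_powr (Lp_Lq_opnorm p q cauchy_transform) q
           \<le> ennreal (2 powr (3 / 2) * (2 / (2 - q / p) + 1 / Gamma (2 - q / p)))"
proof -
  note bound = cauchy_transform_bound[OF assms]
  have q: "2 < q" "q < 3" "2 - q / p = 3 - q"
    using assms(1,2) by (auto simp: assms(3) field_simps)
  define C where "C = (4 / (4 - q))\<^sup>2"
  have 1: "(AE z in disk_area. integrable disk_area (\<lambda>w. cauchy_kernel z w * g w)) \<and> cauchy_transform g \<in> Lp_disk q"
    if "g \<in> Lp_disk p" for g
  proof -
    have g: "g \<in> borel_measurable disk_area" "(\<integral>\<^sup>+z. ennreal (cmod (g z) powr p) \<partial>disk_area) < \<infinity>"
      using that by (auto simp: Lp_disk_def Lp_norm_def enn_powr_less_top_iff)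
    \<comment> \<open>Adding 1 keeps the bound positive when \<open>g\<close> vanishes almost everywhere.\<close>
    define N where "N = enn2real (\<integral>\<^sup>+z. ennreal (cmod (g z) powr p) \<partial>disk_area) + 1"
    have "(\<integral>\<^sup>+z. ennreal (cmod (g z) powr p) \<partial>disk_area) \<le> ennreal N" "0 < N"
      using g(2) by (cases "\<integral>\<^sup>+z. ennreal (cmod (g z) powr p) \<partial>disk_area"; auto simp: N_def intro!: ennreal_leI add_nonneg_pos)+
    note b = bound[OF g(1) this]
    have "(\<integral>\<^sup>+z. ennreal (cmod (cauchy_transform g z) powr q) \<partial>disk_area) < \<infinity>"
      using b(3) by (rule order_le_less_trans) simp
    then show ?thesis
      using b by (simp add: Lp_disk_def Lp_norm_def enn_powr_less_top_iff)
  qed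
  have "Lp_norm q (cauchy_transform g) \<le> ennreal (C powr (1 / q))"
    if "g \<in> Lp_disk p" "Lp_norm p g = 1" for g
  proof -
    have "g \<in> borel_measurable disk_area" "(\<integral>\<^sup>+z. ennreal (cmod (g z) powr p) \<partial>disk_area) \<le> ennreal 1"
      using that assms by (auto simp: Lp_disk_def Lp_norm_def enn_powr_eq_1_iff)
    from bound(3)[OF this]
    have "(\<integral>\<^sup>+z. ennreal (cmod (cauchy_transform g z) powr q) \<partial>disk_area) \<le> ennreal C"
      by (simp add: C_def)
    then have "Lp_norm q (cauchy_transform g) \<le> enn_powr (ennreal C) (1 / q)"
      unfolding Lp_norm_def using q by (intro enn_powr_mono) auto
    then show ?thesis by (simp add: enn_powr_ennreal C_def)
  qed
  then have "Lp_Lq_opnorm p q cauchy_transform \<le> ennreal (C powr (1 / q))"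
    unfolding Lp_Lq_opnorm_def by (intro SUP_least) auto
  then have "enn_powr (Lp_Lq_opnorm p q cauchy_transform) q \<le> enn_powr (ennreal (C powr (1 / q))) q"
    using q by (intro enn_powr_mono) auto
  also have "\<dots> = ennreal C"
    using q by (simp add: enn_powr_ennreal powr_powr C_def)
  also have "\<dots> \<le> ennreal (2 powr (3 / 2) * (2 / (2 - q / p) + 1 / Gamma (2 - q / p)))"
    unfolding q(3) C_def using q by (intro ennreal_leI squared_kernel_bound_le)
  finally show ?thesis using 1 by blast
qed

end
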